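(* Let $G=(V,E)$ be a random power law graph on $n$ vertices with average degree $\nu>1$ and exponent $\beta=2+\varepsilon$ with $0<\varepsilon<1/2$. With high probability over the randomness of $G$, every distance labeling scheme for $G$ that recovers all pairwise distances exactly has total length at least $\Omega(n^{3/2-\varepsilon})$. In particular, with high probability every 2-hop cover of $G$ stores at least $\Omega(n^{3/2-\varepsilon})$ landmarks in total.
   Context: Random power law graph: for $x_{\min}>0$, $\beta>2$, let $f(t)=Zt^{-\beta}$ on $[x_{\min},\infty)$, $Z=(\beta-1)x_{\min}^{\beta-1}$, with mean $\nu$ (the average degree). Each vertex gets an independent weight $p_x\sim f$; given weights, each pair of distinct vertices $x,y$ is an edge independently with probability $\min\{p_xp_y/\mathrm{vol}(V),1\}$, $\mathrm{vol}(V)=\sum_xp_x$. A distance labeling scheme assigns to each vertex $v$ a binary string $\mathcal L(v)$ such that a decoding rule fixed in advance (not depending on $G$) computes $\mathrm{dist}_G(x,y)$ from $\mathcal L(x),\mathcal L(y)$ alone; its total length is $\sum_v|\mathcal L(v)|$. A 2-hop cover is a landmark labeling $\{L(v)\}$ (landmarks stored with their distances) with $\min_{z\in L(x)\cap L(y)}(\mathrm{dist}(x,z)+\mathrm{dist}(z,y))=\mathrm{dist}(x,y)$ for all pairs in the same connected component; its number of landmarks is $\sum_v|L(v)|$. "With high probability" means with probability tending to $1$ as $n\to\infty$. *)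

theory Defs
  imports "HOL-Probability.Probability" "HOL-Library.Extended_Nat"
begin

definition pl_density :: "real \<Rightarrow> real \<Rightarrow> real \<Rightarrow> real" where
  "pl_density xmin \<beta> t =
     (if xmin \<le> t then (\<beta> - 1) * xmin powr (\<beta> - 1) * t powr (- \<beta>) else 0)"

definition pl_weight_measure :: "real \<Rightarrow> real \<Rightarrow> real measure" where
  "pl_weight_measure xmin \<beta> = density lborel (\<lambda>t. ennreal (pl_density xmin \<beta> t))"

definition pl_mean :: "real \<Rightarrow> real \<Rightarrow> real" where
  "pl_mean xmin \<beta> = (\<integral>t. t \<partial>pl_weight_measure xmin \<beta>)"

text \<open>Index set of unordered pairs {x,y} of distinct vertices of V = {0..<n},
  represented as (x,y) with x < y.\<close>
definition vpairs :: "nat \<Rightarrow> (nat \<times> nat) set" where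
  "vpairs n = {p. fst p < snd p \<and> snd p < n}"

text \<open>Sample space: i.i.d. weights p_x ~ f for x < n, and for every pair an
  independent uniform [0,1] variable U_xy; the pair is an edge iff
  U_xy < min (p_x p_y / vol V) 1.  Given the weights, this makes each pair an edge
  independently with probability min (p_x p_y / vol V) 1, i.e. it is exactly the
  random power law graph.\<close>
definition plg_space :: "nat \<Rightarrow> real \<Rightarrow> real \<Rightarrow> ((nat \<Rightarrow> real) \<times> (nat \<times> nat \<Rightarrow> real)) measure" where
  "plg_space n xmin \<beta> =
     (PiM {..<n} (\<lambda>_. pl_weight_measure xmin \<beta>)) \<Otimes>\<^sub>M
     (PiM (vpairs n) (\<lambda>_. uniform_measure lborel {0..1::real}))"

definition plg_adj :: "nat \<Rightarrow> (nat \<Rightarrow> real) \<times> (nat \<times> nat \<Rightarrow> real) \<Rightarrow> nat \<Rightarrow> nat \<Rightarrow> bool" where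
  "plg_adj n \<omega> x y =
     (x < n \<and> y < n \<and> x \<noteq> y \<and>
      snd \<omega> (min x y, max x y)
        < min (fst \<omega> x * fst \<omega> y / (\<Sum>z<n. fst \<omega> z)) 1)"

text \<open>Shortest path distance; infinity if no path exists.\<close>
definition gdist :: "('a \<Rightarrow> 'a \<Rightarrow> bool) \<Rightarrow> 'a \<Rightarrow> 'a \<Rightarrow> enat" where
  "gdist E x y = (INF k \<in> {k. (E ^^ k) x y}. enat k)"

definition is_distance_labeling ::
  "nat \<Rightarrow> (nat \<Rightarrow> nat \<Rightarrow> bool) \<Rightarrow> (bool list \<Rightarrow> bool list \<Rightarrow> enat) \<Rightarrow> (nat \<Rightarrow> bool list) \<Rightarrow> bool" where
  "is_distance_labeling n E Dec Lab =
     (\<forall>x<n. \<forall>y<n. Dec (Lab x) (Lab y) = gdist E x y)"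

definition labeling_length :: "nat \<Rightarrow> (nat \<Rightarrow> bool list) \<Rightarrow> nat" where
  "labeling_length n Lab = (\<Sum>x<n. length (Lab x))"

text \<open>2-hop cover: landmark sets L x (subsets of V), distances to landmarks being
  the true graph distances.\<close>
definition is_2hop_cover :: "nat \<Rightarrow> (nat \<Rightarrow> nat \<Rightarrow> bool) \<Rightarrow> (nat \<Rightarrow> nat set) \<Rightarrow> bool" where
  "is_2hop_cover n E L =
     ((\<forall>x<n. L x \<subseteq> {..<n}) \<and>
      (\<forall>x<n. \<forall>y<n. gdist E x y < \<infinity> \<longrightarrow>
          (INF z \<in> L x \<inter> L y. gdist E x z + gdist E z y) = gdist E x y))"

definition num_landmarks :: "nat \<Rightarrow> (nat \<Rightarrow> nat set) \<Rightarrow> nat" where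
  "num_landmarks n L = (\<Sum>x<n. card (L x))"

end

theory Submission
  imports Defs "HOL-Real_Asymp.Real_Asymp"
begin

text \<open>
  Call the vertices of weight about \<open>\<surd>n\<close> hubs. With high probability there are
  \<open>k \<approx> n powr ((1 - \<epsilon>) / 2)\<close> of them, any two are joined with probability bounded away from 0 and 1,
  and each has of the order of \<open>\<surd>n\<close> neighbours of degree one. If \<open>x\<close> and \<open>x'\<close> are leaves at the hubs
  \<open>h\<close> and \<open>h'\<close>, then \<open>dist x x' = 3\<close> iff \<open>h\<close> and \<open>h'\<close> are adjacent. Pick one leaf per hub: the labels of
  these \<open>k\<close> vertices determine the graph on the hubs, which has entropy of order \<open>k\<^sup>2\<close>, so their total
  length is of order \<open>k\<^sup>2\<close>. There are about \<open>\<surd>n\<close> disjoint choices of such leaves, which gives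
  \<open>\<surd>n * k\<^sup>2 = n powr (3/2 - \<epsilon>)\<close>. For a 2-hop cover no counting is needed, as every edge
  between hubs forces a landmark of its own in every choice of leaves; this saves the logarithmic
  factor that would be lost by encoding landmarks as bit strings.
\<close>

section \<open>Distances between leaves\<close>

text \<open>Two weights of order \<surd>n have a product of order n, comparable with the volume; at
  this scale an edge is a genuine coin toss, and the tail of the density still puts n * n powr (-(1
  + \<epsilon>) / 2) = n powr ((1 - \<epsilon>) / 2) vertices there. A vertex of bounded weight has
  bounded expected degree, so it is a leaf at a given hub with probability of order 1/\<surd>n, and
  linearly many such vertices yield \<surd>n leaves per hub. The obstacle is that the leaves, and
  hence the labels that are read, depend on the random graph. It disappears because the set of hub
  graphs that the decoder can produce from short labels is fixed by the decoder and the hubs before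
  any edge is drawn: the probability that some hub lacks leaves and the probability that the hub
  graph falls into this set are simply added. Leaf counts are controlled by second moments only, so
  the union bound over the k hubs costs about k/\<surd>n = n powr (-\<epsilon>/2). This tends to 0
  exactly because \<epsilon> is positive.\<close>

definition is_leaf :: "('a \<Rightarrow> 'a \<Rightarrow> bool) \<Rightarrow> 'a \<Rightarrow> 'a \<Rightarrow> bool" where
  "is_leaf E h x \<longleftrightarrow> (\<forall>y. E x y \<longleftrightarrow> y = h)"

text \<open>By well-ordering, only the empty set fails to attain its infimum, and its infimum is
  \<infinity>. This extracts a walk from a finite distance and a landmark from the minimum over
  common landmarks.\<close>

lemma Inf_enat_attained:
  fixes S :: "enat set"
  assumes "Inf S \<noteq> \<infinity>"
  shows "Inf S \<in> S"
proof -
  have "S \<noteq> {}" using assms by (auto simp: Inf_enat_def)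
  then show ?thesis by (auto simp: Inf_enat_def intro: LeastI)
qed

lemma gdist_walk:
  assumes "gdist E x y = enat k"
  shows "(E ^^ k) x y"
  using Inf_enat_attained[of "enat ` {k. (E ^^ k) x y}"] assms
  by (auto simp: gdist_def)

lemma relpowp_3_iff: "(E ^^ 3) x y \<longleftrightarrow> (\<exists>a b. E x a \<and> E a b \<and> E b y)" for E :: "'a \<Rightarrow> 'a \<Rightarrow> bool"
  by (auto simp: numeral_3_eq_3 relcompp_apply) 

lemma relpowp_2_iff: "(E ^^ 2) x y \<longleftrightarrow> (\<exists>a. E x a \<and> E a y)" for E :: "'a \<Rightarrow> 'a \<Rightarrow> bool"
  by (auto simp: numeral_2_eq_2 relcompp_apply)

text \<open>A walk between the leaves must leave through \<open>h\<close> and arrive through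
  \<open>h'\<close>, so length 3 requires the edge between the hubs. The inequalities
  \<open>h \<noteq> h'\<close>, \<open>x \<noteq> x'\<close>, \<open>x' \<noteq> h\<close> exclude
  lengths 2, 0 and 1 respectively.\<close>

lemma gdist_leaves_eq_3_iff:
  assumes sym: "\<And>u v. E u v \<Longrightarrow> E v u"
    and leaf: "is_leaf E h x" "is_leaf E h' x'"
    and ne: "h \<noteq> h'" "x \<noteq> x'" "x' \<noteq> h"
  shows "gdist E x x' = 3 \<longleftrightarrow> E h h'"
proof
  assume "gdist E x x' = 3"
  then have "(E ^^ 3) x x'" using gdist_walk[of E x x' 3] by (simp add: numeral_eq_enat)
  then show "E h h'" using leaf sym unfolding relpowp_3_iff is_leaf_def by metis
next
  assume hh: "E h h'"
  have w: "(E ^^ 3) x x'" using leaf sym hh by (auto simp: relpowp_3_iff is_leaf_def)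
  have "3 \<le> k" if k: "(E ^^ k) x x'" for k
  proof (rule ccontr)
    assume "\<not> 3 \<le> k"
    then consider "k = 0" | "k = 1" | "k = 2" by linarith
    then show False
    proof cases
      case 3
      then obtain a where "E x a" "E a x'" using k relpowp_2_iff by metis
      then show False using leaf sym ne unfolding is_leaf_def by metis
    qed (use k leaf ne in \<open>auto simp: is_leaf_def\<close>)
  qed
  then have "3 \<le> gdist E x x'"
    unfolding gdist_def by (auto intro!: INF_greatest simp: numeral_eq_enat)
  moreover have "gdist E x x' \<le> 3"
    unfolding gdist_def using w by (auto intro!: INF_lower2[of 3] simp: numeral_eq_enat)
  ultimately show "gdist E x x' = 3" by simp
qed

text \<open>One of the two distances is at most 1, and a walk of length at most 1 from a leaf ends
  at the leaf itself or at its hub.\<close>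

lemma midpoint_of_leaves:
  assumes sym: "\<And>u v. E u v \<Longrightarrow> E v u"
    and leaf: "is_leaf E h x" "is_leaf E h' x'"
    and z: "gdist E x z + gdist E z x' = 3"
  shows "z \<in> {x, h, h', x'}"
proof -
  obtain i j where ij: "gdist E x z = enat i" "gdist E z x' = enat j" "i + j = 3"
    using z by (cases "gdist E x z"; cases "gdist E z x'") (auto simp: numeral_eq_enat)
  note w = gdist_walk[OF ij(1)] gdist_walk[OF ij(2)]
  from ij(3) consider "i = 0" | "i = 1" | "j = 1" | "j = 0" by linarith
  then show ?thesis
    by cases (use w leaf sym in \<open>auto simp: is_leaf_def\<close>)
qed

text \<open>Exponential weighting: give a string of length i the weight (1/4)^i. All strings
  together weigh at most the sum of 2^i/4^i, that is 2, so all families over \<open>H\<close> weigh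
  at most 2 ^ \<open>card H\<close>, while each family counted here weighs at least (1/4)^T. Base 4
  rather than 2 makes the geometric series converge; bounding the total length this way costs only a
  constant factor per hub.\<close>

lemma card_short_labelings:
  fixes H :: "'a set" and T :: nat
  assumes "finite H"
  defines "S \<equiv> {l \<in> H \<rightarrow>\<^sub>E (UNIV :: bool list set). (\<Sum>h\<in>H. length (l h)) \<le> T}"
  shows "finite S" and "real (card S) \<le> 4 ^ T * 2 ^ card H"
proof -
  \<comment> \<open>Each single label of a family in \<open>S\<close> has length at most
    \<open>T\<close>, so all sums may be taken over a finite set of strings.\<close>
  define A where "A = {xs :: bool list. length xs \<le> T}"
  have finA: "finite A" using finite_lists_length_le[of "UNIV :: bool set" T] by (simp add: A_def)
  have sub: "S \<subseteq> H \<rightarrow>\<^sub>E A"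
  proof
    fix l assume l: "l \<in> S"
    have "length (l h) \<le> T" if "h \<in> H" for h
      using member_le_sum[of h H "\<lambda>h. length (l h)"] that assms(1) l unfolding S_def by force
    then show "l \<in> H \<rightarrow>\<^sub>E A" using l by (auto simp: S_def A_def PiE_iff)
  qed
  have finP: "finite (H \<rightarrow>\<^sub>E A)" using finA assms(1) by (simp add: finite_PiE)
  then show "finite S" using sub finite_subset by blast
  have A1: "(\<Sum>xs\<in>A. (1/4::real) ^ length xs) \<le> 2"
  proof -
    have "(\<Sum>xs\<in>A. (1/4::real) ^ length xs) = (\<Sum>k\<le>T. \<Sum>xs\<in>{xs\<in>A. length xs = k}. (1/4) ^ length xs)"
      by (rule sum.group[symmetric]) (use finA in \<open>auto simp: A_def\<close>)
    also have "\<dots> = (\<Sum>k\<le>T. (1/2) ^ k)"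
    proof (rule sum.cong)
      fix k assume "k \<in> {..T}"
      then have "{xs\<in>A. length xs = k} = {xs. set xs \<subseteq> UNIV \<and> length xs = k}" by (auto simp: A_def)
      then have "card {xs\<in>A. length xs = k} = 2 ^ k"
        using card_lists_length_eq[of "UNIV :: bool set" k] by simp
      then show "(\<Sum>xs\<in>{xs\<in>A. length xs = k}. (1/4::real) ^ length xs) = (1/2) ^ k"
        by (simp add: power_divide power_mult_distrib[symmetric] flip: power_mult_distrib) (simp add: field_simps flip: power_mult_distrib)
    qed simp
    also have "\<dots> \<le> 2" unfolding sum_gp0 by (simp add: field_simps)
    finally show ?thesis .
  qed
  have "real (card S) * (1/4) ^ T = (\<Sum>l\<in>S. (1/4) ^ T)" by simp
  also have "\<dots> \<le> (\<Sum>l\<in>S. (1/4) ^ (\<Sum>h\<in>H. length (l h)))"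
    by (rule sum_mono) (auto simp: S_def intro!: power_decreasing)
  also have "\<dots> \<le> (\<Sum>l\<in>H \<rightarrow>\<^sub>E A. (1/4) ^ (\<Sum>h\<in>H. length (l h)))"
    by (rule sum_mono2[OF finP sub]) simp
  also have "\<dots> = (\<Sum>l\<in>H \<rightarrow>\<^sub>E A. \<Prod>h\<in>H. (1/4) ^ length (l h))"
    by (simp add: power_sum)
  also have "\<dots> = (\<Prod>h\<in>H. \<Sum>xs\<in>A. (1/4) ^ length xs)"
    by (rule prod_sum_PiE[symmetric]) (use finA assms(1) in auto)
  also have "\<dots> \<le> 2 ^ card H"
    using power_mono[OF A1, of "card H"] by (simp add: sum_nonneg)
  finally show "real (card S) \<le> 4 ^ T * 2 ^ card H"
    by (simp add: power_divide field_simps)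
qed

section \<open>Graphs as edge indicators, and arrays of leaves\<close>

definition edge :: "nat \<Rightarrow> nat \<Rightarrow> nat \<times> nat" where
  "edge x y = (min x y, max x y)"

definition graph_adj :: "nat \<Rightarrow> (nat \<times> nat \<Rightarrow> bool) \<Rightarrow> nat \<Rightarrow> nat \<Rightarrow> bool" where
  "graph_adj n F x y \<longleftrightarrow> x < n \<and> y < n \<and> x \<noteq> y \<and> F (edge x y)"

definition pairs_in :: "nat set \<Rightarrow> (nat \<times> nat) set" where
  "pairs_in H = {e. fst e < snd e \<and> fst e \<in> H \<and> snd e \<in> H}"

text \<open>Row \<open>j\<close> is one choice of a leaf for every hub. Injectivity makes the rows
  disjoint, so that costs add up over rows; keeping the leaves outside \<open>H\<close> supplies the
  condition \<open>x' \<noteq> h\<close> of \<open>gdist_leaves_eq_3_iff\<close>.\<close>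

definition leaf_array :: "nat \<Rightarrow> (nat \<Rightarrow> nat \<Rightarrow> bool) \<Rightarrow> nat set \<Rightarrow> nat \<Rightarrow> (nat \<Rightarrow> nat \<Rightarrow> nat) \<Rightarrow> bool" where
  "leaf_array n E H m l \<longleftrightarrow>
     (\<forall>j<m. \<forall>h\<in>H. l j h < n \<and> l j h \<notin> H \<and> is_leaf E h (l j h)) \<and>
     inj_on (\<lambda>(j, h). l j h) ({..<m} \<times> H)"

lemma edge_commute: "edge x y = edge y x"
  by (simp add: edge_def min.commute max.commute)

lemma edge_in_vpairs [simp]: "edge x y \<in> vpairs n \<longleftrightarrow> x < n \<and> y < n \<and> x \<noteq> y"
  by (auto simp: edge_def vpairs_def min_def max_def)

lemma edge_fst_snd: "fst e < snd e \<Longrightarrow> edge (fst e) (snd e) = e"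
  by (simp add: edge_def min_def max_def)

lemma graph_adj_sym: "graph_adj n F x y \<Longrightarrow> graph_adj n F y x"
  by (auto simp: graph_adj_def edge_commute)

lemma finite_vpairs [simp]: "finite (vpairs n)"
  by (rule finite_subset[of _ "{..<n} \<times> {..<n}"]) (auto simp: vpairs_def)

lemma finite_pairs_in: "finite H \<Longrightarrow> finite (pairs_in H)"
  by (rule finite_subset[of _ "H \<times> H"]) (auto simp: pairs_in_def)

lemma pairs_in_subset_vpairs: "H \<subseteq> {..<n} \<Longrightarrow> pairs_in H \<subseteq> vpairs n"
  by (auto simp: pairs_in_def vpairs_def)

text \<open>The binomial coefficient k(k-1)/2, stated additively to avoid subtraction and division
  on naturals. Adding a new maximum \<open>b\<close> creates one pair (h, b) for every old
  \<open>h\<close>.\<close>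

lemma card_pairs_in:
  assumes "finite H"
  shows "2 * card (pairs_in H) + card H = (card H)\<^sup>2"
  using assms
proof (induction H rule: finite_linorder_max_induct)
  case empty
  then show ?case by (simp add: pairs_in_def)
next
  case (insert b H)
  have "pairs_in (insert b H) = pairs_in H \<union> (\<lambda>h. (h, b)) ` H"
    using insert.hyps(2) by (force simp: pairs_in_def)
  moreover have "card (pairs_in H \<union> (\<lambda>h. (h, b)) ` H) = card (pairs_in H) + card H"
    using insert.hyps
    by (subst card_Un_disjoint) (auto simp: finite_pairs_in card_image inj_on_def, auto simp: pairs_in_def)
  moreover have "b \<notin> H" using insert.hyps(2) by auto
  ultimately show ?case
    using insert by (simp add: power2_eq_square)
qed

text \<open>A leaf determines its hub, so leaves chosen at different hubs can never collide and the
  choice is made for each hub separately.\<close>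

lemma ex_leaf_array:
  assumes "B \<subseteq> {..<n}" "B \<inter> H = {}"
    and many: "\<And>h. h \<in> H \<Longrightarrow> m \<le> card {x \<in> B. is_leaf E h x}"
  shows "\<exists>l. leaf_array n E H m l"
proof -
  have "\<exists>f. inj_on f {..<m} \<and> f ` {..<m} \<subseteq> {x \<in> B. is_leaf E h x}" if "h \<in> H" for h
  proof -
    obtain S where S: "S \<subseteq> {x \<in> B. is_leaf E h x}" "card S = m" "finite S"
      by (rule obtain_subset_with_card_n[OF many[OF \<open>h \<in> H\<close>]])
    then obtain f where "bij_betw f {..<m} S"
      using ex_bij_betw_nat_finite[of S] by (auto simp: atLeast0LessThan)
    then show ?thesis using S by (auto simp: bij_betw_def)
  qed
  then obtain f where f: "\<And>h. h \<in> H \<Longrightarrow> inj_on (f h) {..<m} \<and> f h ` {..<m} \<subseteq> {x \<in> B. is_leaf E h x}"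
    by metis
  have leaf: "is_leaf E h (f h j)" if "h \<in> H" "j < m" for h j using f that by auto
  have "inj_on (\<lambda>(j, h). f h j) ({..<m} \<times> H)"
  proof (rule inj_onI, clarsimp)
    fix j h j' h' assume *: "j < m" "h \<in> H" "j' < m" "h' \<in> H" "f h j = f h' j'"
    then have "h = h'" using leaf[of h j] leaf[of h' j'] by (auto simp: is_leaf_def)
    with * f[of h] show "j = j' \<and> h = h'" by (auto dest: inj_onD)
  qed
  then have "leaf_array n E H m (\<lambda>j h. f h j)"
    using f assms(1,2) leaf unfolding leaf_array_def by fastforce
  then show ?thesis by blast
qed

lemma sum_over_leaf_array_le:
  fixes w :: "nat \<Rightarrow> nat"
  assumes "leaf_array n E H m l" "finite H"
  shows "(\<Sum>j<m. \<Sum>h\<in>H. w (l j h)) \<le> (\<Sum>x<n. w x)"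
proof -
  have "(\<Sum>j<m. \<Sum>h\<in>H. w (l j h)) = (\<Sum>a\<in>{..<m} \<times> H. w (case a of (j, h) \<Rightarrow> l j h))"
    by (simp add: sum.cartesian_product case_prod_beta)
  also have "\<dots> = sum w ((\<lambda>(j, h). l j h) ` ({..<m} \<times> H))"
    using assms by (subst sum.reindex) (auto simp: leaf_array_def)
  also have "\<dots> \<le> (\<Sum>x<n. w x)"
    using assms by (intro sum_mono2) (auto simp: leaf_array_def)
  finally show ?thesis .
qed

lemma gdist_leaf_array_eq_3_iff:
  assumes "leaf_array n E H m l" and sym: "\<And>u v. E u v \<Longrightarrow> E v u"
    and "j < m" "h \<in> H" "h' \<in> H" "h \<noteq> h'"
  shows "gdist E (l j h) (l j h') = 3 \<longleftrightarrow> E h h'"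
proof (rule gdist_leaves_eq_3_iff)
  show "l j h \<noteq> l j h'"
    using assms inj_onD[of "\<lambda>(j, h). l j h" "{..<m} \<times> H" "(j, h)" "(j, h')"]
    by (auto simp: leaf_array_def)
qed (use assms in \<open>auto simp: leaf_array_def\<close>)

text \<open>By averaging, some row of the array carries short labels. Since the decoder is fixed, these labels
  alone determine the graph on \<open>H\<close>, whatever the row and whatever the rest of the graph.\<close>
lemma short_labeling_determines_hub_graph:
  fixes Dec :: "bool list \<Rightarrow> bool list \<Rightarrow> enat"
  assumes arr: "leaf_array n E H m l" and "finite H" and sym: "\<And>u v. E u v \<Longrightarrow> E v u"
    and lab: "is_distance_labeling n E Dec Lab" and short: "labeling_length n Lab < m * Suc T"
  shows "\<exists>lab \<in> {lab \<in> H \<rightarrow>\<^sub>E UNIV. (\<Sum>h\<in>H. length (lab h)) \<le> T}.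
           \<forall>h\<in>H. \<forall>h'\<in>H. h \<noteq> h' \<longrightarrow> (E h h' \<longleftrightarrow> Dec (lab h) (lab h') = 3)"
proof -
  have "\<exists>j<m. (\<Sum>h\<in>H. length (Lab (l j h))) \<le> T"
  proof (rule ccontr)
    assume "\<not> ?thesis"
    \<comment> \<open>A row that exceeds \<open>T\<close> has total length at least
      \<open>Suc T\<close>, which is why the hypothesis speaks of \<open>m * Suc T\<close>.\<close>
    then have "(\<Sum>j<m. Suc T) \<le> (\<Sum>j<m. \<Sum>h\<in>H. length (Lab (l j h)))"
      by (intro sum_mono) (auto simp: not_le)
    also have "\<dots> \<le> labeling_length n Lab"
      unfolding labeling_length_def by (rule sum_over_leaf_array_le[OF arr \<open>finite H\<close>])
    finally show False using short by simp
  qed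
  then obtain j where j: "j < m" "(\<Sum>h\<in>H. length (Lab (l j h))) \<le> T" by blast
  \<comment> \<open>Restriction to \<open>H\<close> places the row in the extensional function
    space, the finite family counted by \<open>card_short_labelings\<close>.\<close>
  define lab where "lab = restrict (\<lambda>h. Lab (l j h)) H"
  have "E h h' \<longleftrightarrow> Dec (lab h) (lab h') = 3" if "h \<in> H" "h' \<in> H" "h \<noteq> h'" for h h'
    using gdist_leaf_array_eq_3_iff[OF arr sym j(1) that] lab that j(1) arr
    by (simp add: lab_def is_distance_labeling_def leaf_array_def)
  moreover have "lab \<in> {lab \<in> H \<rightarrow>\<^sub>E UNIV. (\<Sum>h\<in>H. length (lab h)) \<le> T}"
    using j(2) by (simp add: lab_def)
  ultimately show ?thesis by blast
qed

text \<open>The walk of length 3 between the leaves of two adjacent hubs is unique, so their common landmark lies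
  on it. It is charged to the leaf at the far end, where it identifies the other hub.\<close>
lemma two_hop_cover_charges_hub_edges:
  assumes arr: "leaf_array n E H m l" and "finite H" and sym: "\<And>u v. E u v \<Longrightarrow> E v u"
    and cover: "is_2hop_cover n E L"
  shows "m * card {e \<in> pairs_in H. E (fst e) (snd e)} \<le> num_landmarks n L"
proof -
  define EH where "EH = {e \<in> pairs_in H. E (fst e) (snd e)}"
  have row: "card EH \<le> (\<Sum>h\<in>H. card (L (l j h)))" if j: "j < m" for j
  proof -
    have leaf: "l j h < n" "l j h \<notin> H" "is_leaf E h (l j h)" if "h \<in> H" for h
      using arr j that by (auto simp: leaf_array_def)
    have inj: "h = h'" if "l j h = l j h'" "h \<in> H" "h' \<in> H" for h h'
      using arr j that inj_onD[of "\<lambda>(j, h). l j h" "{..<m} \<times> H" "(j, h)" "(j, h')"]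
      by (auto simp: leaf_array_def)
    have finL: "finite (L (l j h))" if "h \<in> H" for h
      using cover leaf(1)[OF that] finite_subset[OF _ finite_lessThan]
      unfolding is_2hop_cover_def by blast
    have "\<exists>z. z \<in> L (l j u) \<and> z \<in> L (l j v) \<and> z \<in> {l j u, u, v, l j v}"
      if uv: "u \<in> H" "v \<in> H" "u \<noteq> v" "E u v" for u v
    proof -
      have "gdist E (l j u) (l j v) = 3"
        using gdist_leaf_array_eq_3_iff[OF arr sym j] uv by blast
      then have inf3: "(INF z \<in> L (l j u) \<inter> L (l j v). gdist E (l j u) z + gdist E z (l j v)) = 3"
        using cover leaf(1) uv by (simp add: is_2hop_cover_def numeral_eq_enat)
      then obtain z where "z \<in> L (l j u) \<inter> L (l j v)" "gdist E (l j u) z + gdist E z (l j v) = 3"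
        using Inf_enat_attained[of "(\<lambda>z. gdist E (l j u) z + gdist E z (l j v)) ` (L (l j u) \<inter> L (l j v))"]
        by (auto simp: numeral_eq_enat)
      then show ?thesis
        using midpoint_of_leaves[OF sym leaf(3)[OF uv(1)] leaf(3)[OF uv(2)]] by blast
    qed
    then have "\<forall>e\<in>EH. \<exists>z. z \<in> L (l j (fst e)) \<and> z \<in> L (l j (snd e)) \<and>
        z \<in> {l j (fst e), fst e, snd e, l j (snd e)}"
      by (auto simp: EH_def pairs_in_def less_imp_neq)
    from bchoice[OF this] obtain z where z: "\<And>e. e \<in> EH \<Longrightarrow> z e \<in> L (l j (fst e)) \<and>
        z e \<in> L (l j (snd e)) \<and> z e \<in> {l j (fst e), fst e, snd e, l j (snd e)}"
      by blast
    define owner where "owner = (\<lambda>e. if z e \<in> {l j (fst e), fst e} then snd e else fst e)"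
    define other where "other = (\<lambda>e. if z e \<in> {l j (fst e), fst e} then fst e else snd e)"
    have EH: "fst e \<in> H" "snd e \<in> H" "fst e < snd e" if "e \<in> EH" for e
      using that by (auto simp: EH_def pairs_in_def)
    have edge: "edge (owner e) (other e) = e" if "e \<in> EH" for e
      using EH[OF that] by (auto simp: owner_def other_def edge_def prod_eq_iff)
    have other: "z e = other e \<or> z e = l j (other e)" "other e \<in> H" if "e \<in> EH" for e
      using z[OF that] EH[OF that] by (auto simp: other_def)
    have "inj_on (\<lambda>e. (owner e, z e)) EH"
    proof (rule inj_onI)
      fix e e' assume e: "e \<in> EH" "e' \<in> EH" "(owner e, z e) = (owner e', z e')"
      \<comment> \<open>A hub cannot coincide with a leaf of the array, and the row is injective on
        \<open>H\<close>; hence the landmark alone reveals \<open>other e\<close>, whichever of its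
        two forms it takes.\<close>
      then have "other e = other e'"
        using other[OF e(1)] other[OF e(2)] leaf(2) inj by force
      then show "e = e'" using edge e by (metis prod.inject)
    qed
    moreover have "(\<lambda>e. (owner e, z e)) ` EH \<subseteq> Sigma H (\<lambda>h. L (l j h))"
      using z EH by (auto simp: owner_def)
    ultimately have "card EH \<le> card (Sigma H (\<lambda>h. L (l j h)))"
      using \<open>finite H\<close> finL by (intro card_inj_on_le) auto
    then show ?thesis using \<open>finite H\<close> finL by simp
  qed
  have "m * card EH = (\<Sum>j<m. card EH)" by simp
  also have "\<dots> \<le> (\<Sum>j<m. \<Sum>h\<in>H. card (L (l j h)))" using row by (intro sum_mono) simp
  also have "\<dots> \<le> num_landmarks n L"
    unfolding num_landmarks_def by (rule sum_over_leaf_array_le[OF arr \<open>finite H\<close>])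
  finally show ?thesis unfolding EH_def .
qed

section \<open>Second moment bounds\<close>

text \<open>Chebyshev's inequality for summands that are only almost uncorrelated: the off-diagonal
  excess contributes \<tau> * \<mu>^2 to the variance. The diagonal is kept as raw second moments,
  which suits indicators and truncated weights alike.\<close>

lemma (in prob_space) second_moment:
  fixes X :: "'i \<Rightarrow> 'a \<Rightarrow> real"
  assumes "finite I"
    and int: "\<And>i. i \<in> I \<Longrightarrow> integrable M (X i)"
    and int2: "\<And>i j. i \<in> I \<Longrightarrow> j \<in> I \<Longrightarrow> integrable M (\<lambda>\<omega>. X i \<omega> * X j \<omega>)"
    and nonneg: "\<And>i. i \<in> I \<Longrightarrow> 0 \<le> expectation (X i)"
    and corr: "\<And>i j. i \<in> I \<Longrightarrow> j \<in> I \<Longrightarrow> i \<noteq> j \<Longrightarrow>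
        expectation (\<lambda>\<omega>. X i \<omega> * X j \<omega>) \<le> (1 + \<tau>) * (expectation (X i) * expectation (X j))"
    and "0 \<le> \<tau>"
    and \<mu>: "\<mu> = (\<Sum>i\<in>I. expectation (X i))" "0 < \<mu>"
  shows "prob {\<omega> \<in> space M. \<mu> / 2 \<le> \<bar>(\<Sum>i\<in>I. X i \<omega>) - \<mu>\<bar>}
       \<le> 4 * ((\<Sum>i\<in>I. expectation (\<lambda>\<omega>. (X i \<omega>)\<^sup>2)) / \<mu>\<^sup>2 + \<tau>)"
proof -
  define S where "S = (\<lambda>\<omega>. \<Sum>i\<in>I. X i \<omega>)"
  have iS: "integrable M S" unfolding S_def using int by auto
  have S2: "(S \<omega>)\<^sup>2 = (\<Sum>i\<in>I. \<Sum>j\<in>I. X i \<omega> * X j \<omega>)" for \<omega>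
    by (simp add: S_def power2_eq_square sum_product)
  have iS2: "integrable M (\<lambda>\<omega>. (S \<omega>)\<^sup>2)" unfolding S2 using int2 by auto
  have ES: "expectation S = \<mu>" unfolding S_def \<mu>(1) using int by simp
  have "expectation (\<lambda>\<omega>. (S \<omega>)\<^sup>2) = (\<Sum>i\<in>I. \<Sum>j\<in>I. expectation (\<lambda>\<omega>. X i \<omega> * X j \<omega>))"
    unfolding S2 using int2 by (simp add: integral_sum)
  \<comment> \<open>On the diagonal the product of expectations is added although it is not there;
    it is nonnegative and completes the double sum to (1 + \<tau>) * \<mu>^2.\<close>
  also have "\<dots> \<le> (\<Sum>i\<in>I. \<Sum>j\<in>I. (if i = j then expectation (\<lambda>\<omega>. (X i \<omega>)\<^sup>2) else 0)
        + (1 + \<tau>) * (expectation (X i) * expectation (X j)))"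
    using corr nonneg \<open>0 \<le> \<tau>\<close>
    by (intro sum_mono) (auto simp: power2_eq_square)
  also have "\<dots> = (\<Sum>i\<in>I. expectation (\<lambda>\<omega>. (X i \<omega>)\<^sup>2)) + (1 + \<tau>) * \<mu>\<^sup>2"
    using \<open>finite I\<close> by (simp add: sum.distrib \<mu>(1) power2_eq_square[of "sum _ _"] sum_product flip: sum_distrib_left)
  finally have "variance S \<le> (\<Sum>i\<in>I. expectation (\<lambda>\<omega>. (X i \<omega>)\<^sup>2)) + \<tau> * \<mu>\<^sup>2"
    using variance_eq[OF iS iS2] by (simp add: ES algebra_simps)
  then have "variance S / (\<mu> / 2)\<^sup>2 \<le> 4 * ((\<Sum>i\<in>I. expectation (\<lambda>\<omega>. (X i \<omega>)\<^sup>2)) / \<mu>\<^sup>2 + \<tau>)"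
    using \<mu>(2) by (simp add: field_simps power2_eq_square)
  then show ?thesis
    using Chebyshev_inequality[OF borel_measurable_integrable[OF iS] iS2, of "\<mu> / 2"] \<mu>(2)
    by (simp add: ES) (simp add: S_def)
qed

text \<open>An indicator is its own square, so the diagonal term becomes 1/\<mu>. Since this
  decreases in the mean, a lower bound \<open>m\<close> for the mean suffices.\<close>

lemma (in prob_space) second_moment_events:
  assumes "finite I"
    and A: "\<And>i. i \<in> I \<Longrightarrow> A i \<in> events"
    and corr: "\<And>i j. i \<in> I \<Longrightarrow> j \<in> I \<Longrightarrow> i \<noteq> j \<Longrightarrow>
        prob (A i \<inter> A j) \<le> (1 + \<tau>) * (prob (A i) * prob (A j))"
    and "0 \<le> \<tau>"
    and m: "0 < m" "m \<le> (\<Sum>i\<in>I. prob (A i))"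
  shows "prob {\<omega> \<in> space M. real (card {i \<in> I. \<omega> \<in> A i}) < m / 2} \<le> 4 * (1 / m + \<tau>)"
proof -
  define \<mu> where "\<mu> = (\<Sum>i\<in>I. prob (A i))"
  define X where "X = (\<lambda>i. indicat_real (A i))"
  have \<mu>0: "0 < \<mu>" using m by (simp add: \<mu>_def)
  have EX: "expectation (X i) = prob (A i)" if "i \<in> I" for i
    using A[OF that] by (simp add: X_def)
  have EXX: "expectation (\<lambda>\<omega>. X i \<omega> * X j \<omega>) = prob (A i \<inter> A j)" if "i \<in> I" "j \<in> I" for i j
    using A that by (simp add: X_def flip: indicator_inter_arith)
  have card: "(\<Sum>i\<in>I. X i \<omega>) = real (card {i \<in> I. \<omega> \<in> A i})" for \<omega>
    using \<open>finite I\<close> by (simp add: X_def indicator_def sum.If_cases Int_def)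
  have meas: "(\<lambda>\<omega>. \<Sum>i\<in>I. X i \<omega>) \<in> borel_measurable M"
    unfolding X_def using A by (intro borel_measurable_sum) auto
  have "prob {\<omega> \<in> space M. real (card {i \<in> I. \<omega> \<in> A i}) < m / 2}
      \<le> prob {\<omega> \<in> space M. \<mu> / 2 \<le> \<bar>(\<Sum>i\<in>I. X i \<omega>) - \<mu>\<bar>}"
  proof (rule finite_measure_mono)
    show "{\<omega> \<in> space M. \<mu> / 2 \<le> \<bar>(\<Sum>i\<in>I. X i \<omega>) - \<mu>\<bar>} \<in> events"
      using meas by measurable
  qed (use m in \<open>auto simp: card \<mu>_def\<close>)
  also have "\<dots> \<le> 4 * ((\<Sum>i\<in>I. expectation (\<lambda>\<omega>. (X i \<omega>)\<^sup>2)) / \<mu>\<^sup>2 + \<tau>)"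
  proof (rule second_moment[OF \<open>finite I\<close>])
    show "integrable M (X i)" if "i \<in> I" for i
      using A[OF that] by (simp add: X_def integrable_indicator_iff emeasure_eq_measure)
    show "integrable M (\<lambda>\<omega>. X i \<omega> * X j \<omega>)" if "i \<in> I" "j \<in> I" for i j
      using A that by (simp add: X_def integrable_indicator_iff emeasure_eq_measure flip: indicator_inter_arith)
  qed (use EX EXX corr \<open>0 \<le> \<tau>\<close> \<mu>0 in \<open>auto simp: \<mu>_def\<close>)
  also have "(\<Sum>i\<in>I. expectation (\<lambda>\<omega>. (X i \<omega>)\<^sup>2)) = \<mu>"
    using EXX by (simp add: power2_eq_square \<mu>_def)
  also have "\<mu> / \<mu>\<^sup>2 \<le> 1 / m"
    using m \<mu>0 by (simp add: power2_eq_square \<mu>_def frac_le)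
  finally show ?thesis by simp
qed

section \<open>Random graphs with independent edges\<close>

text \<open>The law of the graph once the weights are fixed, kept discrete so that every event is
  measurable. \<open>False\<close> is the value at indices that are not pairs of vertices.\<close>

definition edge_pmf :: "nat \<Rightarrow> (nat \<times> nat \<Rightarrow> real) \<Rightarrow> (nat \<times> nat \<Rightarrow> bool) pmf" where
  "edge_pmf n q = Pi_pmf (vpairs n) False (\<lambda>e. bernoulli_pmf (q e))"

lemma prob_bernoulli_singleton:
  assumes "0 \<le> q" "q \<le> 1"
  shows "measure_pmf.prob (bernoulli_pmf q) {b} = (if b then q else 1 - q)"
  using assms by (simp add: measure_pmf_single)

text \<open>The common source of the probabilities below: a hub graph, one leaf and two leaves are
  all prescribed patterns on a set of pairs.\<close>

lemma prob_edge_pmf_restrict: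
  assumes q: "\<And>e. 0 \<le> q e \<and> q e \<le> 1" and "A \<subseteq> vpairs n"
  shows "measure_pmf.prob (edge_pmf n q) {F. \<forall>e\<in>A. F e = a e} = (\<Prod>e\<in>A. if a e then q e else 1 - q e)"
proof -
  have "{F. \<forall>e\<in>A. F e = a e} = Pi (vpairs n) (\<lambda>e. if e \<in> A then {a e} else UNIV)"
    using assms(2) by (auto simp: Pi_def split: if_splits)
  then have "measure_pmf.prob (edge_pmf n q) {F. \<forall>e\<in>A. F e = a e}
      = (\<Prod>e\<in>vpairs n. if e \<in> A then (if a e then q e else 1 - q e) else 1)"
    using q unfolding edge_pmf_def
    by (simp add: measure_Pi_pmf_Pi if_distrib[of "measure_pmf.prob _"] prob_bernoulli_singleton cong: if_cong)
  also have "\<dots> = (\<Prod>e\<in>A. if a e then q e else 1 - q e)"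
    using assms(2) by (simp add: prod.If_cases Int_absorb1)
  finally show ?thesis .
qed

text \<open>A min-entropy bound: no single pattern on \<open>A\<close> is more likely than (1 -
  \<eta>) ^ \<open>card A\<close>, and the union bound is taken over \<open>\<Phi>\<close>.\<close>

lemma prob_hub_graph_in_small_set:
  fixes \<eta> :: real
  assumes q: "\<And>e. 0 \<le> q e \<and> q e \<le> 1" and A: "A \<subseteq> vpairs n"
    and \<eta>: "\<And>e. e \<in> A \<Longrightarrow> \<eta> \<le> q e \<and> q e \<le> 1 - \<eta>"
    and "finite \<Phi>"
  shows "measure_pmf.prob (edge_pmf n q) {F. \<exists>a\<in>\<Phi>. \<forall>e\<in>A. F e = a e} \<le> real (card \<Phi>) * (1 - \<eta>) ^ card A"
proof -
  have "{F. \<exists>a\<in>\<Phi>. \<forall>e\<in>A. F e = a e} = (\<Union>a\<in>\<Phi>. {F. \<forall>e\<in>A. F e = a e})" by auto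
  then have "measure_pmf.prob (edge_pmf n q) {F. \<exists>a\<in>\<Phi>. \<forall>e\<in>A. F e = a e}
      \<le> (\<Sum>a\<in>\<Phi>. measure_pmf.prob (edge_pmf n q) {F. \<forall>e\<in>A. F e = a e})"
    using \<open>finite \<Phi>\<close> by (simp add: measure_pmf.finite_measure_subadditive_finite)
  also have "\<dots> \<le> (\<Sum>a\<in>\<Phi>. (1 - \<eta>) ^ card A)"
  proof (rule sum_mono)
    fix a
    have "(\<Prod>e\<in>A. if a e then q e else 1 - q e) \<le> (\<Prod>e\<in>A. 1 - \<eta>)"
    proof (rule prod_mono)
      fix e assume "e \<in> A"
      then show "0 \<le> (if a e then q e else 1 - q e) \<and> (if a e then q e else 1 - q e) \<le> 1 - \<eta>"
        using q[of e] \<eta>[of e] by auto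
    qed
    then show "measure_pmf.prob (edge_pmf n q) {F. \<forall>e\<in>A. F e = a e} \<le> (1 - \<eta>) ^ card A"
      by (simp add: prob_edge_pmf_restrict[OF q A])
  qed
  finally show ?thesis by simp
qed

text \<open>Distinct pairs are independent, so the second moment bound applies with correlation
  0.\<close>

lemma prob_few_hub_edges:
  assumes q: "\<And>e. 0 \<le> q e \<and> q e \<le> 1" and A: "A \<subseteq> vpairs n" "A \<noteq> {}"
    and \<eta>: "0 < \<eta>" "\<And>e. e \<in> A \<Longrightarrow> \<eta> \<le> q e"
  shows "measure_pmf.prob (edge_pmf n q) {F. real (card {e \<in> A. F e}) < \<eta> * card A / 2}
      \<le> 4 / (\<eta> * card A)"
proof -
  have finA: "finite A" using A(1) finite_subset[OF _ finite_vpairs] by blast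
  have p1: "measure_pmf.prob (edge_pmf n q) {F. F e} = q e" if "e \<in> A" for e
    using prob_edge_pmf_restrict[where q=q and A="{e}" and a="\<lambda>_. True", OF q] A(1) that by auto
  have p2: "measure_pmf.prob (edge_pmf n q) ({F. F e} \<inter> {F. F e'}) = q e * q e'"
    if "e \<in> A" "e' \<in> A" "e \<noteq> e'" for e e'
    using prob_edge_pmf_restrict[where q=q and A="{e, e'}" and a="\<lambda>_. True" and n=n, OF q] that
      subsetD[OF A(1) that(1)] subsetD[OF A(1) that(2)]
    by (simp add: Collect_conj_eq)
  have "real (card A) * \<eta> \<le> sum q A" using \<eta>(2) sum_bounded_below[of A \<eta> q] by simp
  then have "measure_pmf.prob (edge_pmf n q)
      {F \<in> space (measure_pmf (edge_pmf n q)). real (card {e \<in> A. F \<in> {F. F e}}) < \<eta> * card A / 2}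
      \<le> 4 * (1 / (\<eta> * card A) + 0)"
    using p1 p2 finA A(2) \<eta>(1)
    by (intro measure_pmf.second_moment_events) (auto simp: card_gt_0_iff mult.commute)
  then show ?thesis by simp
qed

section \<open>Probabilities and correlations of leaves\<close>

definition star :: "nat \<Rightarrow> nat \<Rightarrow> (nat \<times> nat) set" where
  "star n x = edge x ` ({..<n} - {x})"

lemma star_subset: "x < n \<Longrightarrow> star n x \<subseteq> vpairs n"
  by (auto simp: star_def)

lemma edge_eq_iff: "edge x y = edge x z \<longleftrightarrow> y = z"
  by (auto simp: edge_def min_def max_def)

lemma inj_on_edge: "inj_on (edge x) S"
  by (auto simp: inj_on_def edge_eq_iff)

lemma finite_star [simp]: "finite (star n x)"
  by (simp add: star_def)

lemma star_Int_star:
  assumes "x < n" "x' < n" "x \<noteq> x'"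
  shows "star n x \<inter> star n x' = {edge x x'}"
proof -
  have "edge x x' \<in> star n x'" using assms by (auto simp: star_def edge_commute[of x x'])
  moreover have "star n x \<inter> star n x' \<subseteq> {edge x x'}"
    using assms(3) by (auto simp: star_def edge_def min_def max_def split: if_splits)
  ultimately show ?thesis using assms by (auto simp: star_def)
qed

lemma is_leaf_iff_star:
  assumes "x < n" "h < n" "h \<noteq> x"
  shows "is_leaf (graph_adj n F) h x \<longleftrightarrow> (\<forall>e\<in>star n x. F e = (e = edge x h))"
  using assms by (auto simp: is_leaf_def graph_adj_def star_def edge_eq_iff)

lemma prob_leaf:
  assumes q: "\<And>e. 0 \<le> q e \<and> q e \<le> 1" and x: "x < n" "h < n" "h \<noteq> x"
  shows "measure_pmf.prob (edge_pmf n q) {F. is_leaf (graph_adj n F) h x}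
      = (\<Prod>e\<in>star n x. if e = edge x h then q e else 1 - q e)"
  unfolding is_leaf_iff_star[OF x] by (rule prob_edge_pmf_restrict[OF q star_subset[OF x(1)]])

text \<open>The one required edge contributes q; every other pair at \<open>x\<close> contributes 1
  - t \<ge> exp (-2t), valid for t \<le> 1/2, and these exponents sum to at most 2D.\<close>

lemma prob_leaf_ge:
  assumes q: "\<And>e. 0 \<le> q e \<and> q e \<le> 1" and x: "x < n" "h < n" "h \<noteq> x"
    and half: "\<And>y. y < n \<Longrightarrow> y \<noteq> x \<Longrightarrow> q (edge x y) \<le> 1/2"
    and deg: "(\<Sum>y\<in>{..<n} - {x}. q (edge x y)) \<le> D"
  shows "measure_pmf.prob (edge_pmf n q) {F. is_leaf (graph_adj n F) h x} \<ge> q (edge x h) * exp (- 2 * D)"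
proof -
  have exp_le: "exp (- 2 * t) \<le> 1 - t" if "0 \<le> t" "t \<le> 1/2" for t :: real
  proof -
    \<comment> \<open>The product equals 1 + t(1 - 2t).\<close>
    have "1 \<le> (1 - t) * (1 + 2 * t)"
      using that mult_left_mono[of "2 * t" 1 t] by (simp add: algebra_simps)
    also have "\<dots> \<le> (1 - t) * exp (2 * t)" using that by (intro mult_left_mono exp_ge_add_one_self) auto
    finally show ?thesis by (simp add: exp_minus field_simps)
  qed
  define S where "S = star n x - {edge x h}"
  have S: "edge x h \<in> star n x" "finite S" using x by (auto simp: star_def S_def)
  have "(\<Sum>e\<in>S. q e) \<le> (\<Sum>e\<in>star n x. q e)"
    using q by (intro sum_mono2) (auto simp: S_def)
  also have "\<dots> \<le> D" using deg by (simp add: star_def sum.reindex inj_on_edge)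
  finally have "exp (- 2 * D) \<le> exp (\<Sum>e\<in>S. - 2 * q e)" unfolding sum_distrib_left[symmetric] by simp
  also have "\<dots> = (\<Prod>e\<in>S. exp (- 2 * q e))" by (simp add: exp_sum S)
  also have "\<dots> \<le> (\<Prod>e\<in>S. 1 - q e)"
  proof (intro prod_mono conjI exp_le)
    fix e assume "e \<in> S"
    then obtain y where "e = edge x y" "y < n" "y \<noteq> x" by (auto simp: S_def star_def)
    then show "q e \<le> 1/2" using half by blast
  qed (use q in auto)
  finally have "q (edge x h) * exp (- 2 * D) \<le> q (edge x h) * (\<Prod>e\<in>S. 1 - q e)"
    using q by (intro mult_left_mono) auto
  also have "\<dots> = (\<Prod>e\<in>star n x. if e = edge x h then q e else 1 - q e)"
    using S(1) by (subst prod.remove[of _ "edge x h"]) (auto simp: S_def intro!: prod.cong)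
  finally show ?thesis using prob_leaf[OF q x] by simp
qed

text \<open>The two stars share only the pair of \<open>x\<close> and \<open>x'\<close>, which both
  events require to be absent. The product of the two probabilities counts its factor twice, the
  joint probability once; multiplying by this factor states the relation without division.\<close>

lemma prob_two_leaves:
  assumes q: "\<And>e. 0 \<le> q e \<and> q e \<le> 1" and x: "x < n" "x' < n" "h < n" "h \<noteq> x" "h \<noteq> x'" "x \<noteq> x'"
  shows "measure_pmf.prob (edge_pmf n q)
        ({F. is_leaf (graph_adj n F) h x} \<inter> {F. is_leaf (graph_adj n F) h x'}) * (1 - q (edge x x'))
     = measure_pmf.prob (edge_pmf n q) {F. is_leaf (graph_adj n F) h x} *
       measure_pmf.prob (edge_pmf n q) {F. is_leaf (graph_adj n F) h x'}"
proof -
  \<comment> \<open>The combined pattern. On the star of \<open>x\<close> it agrees with the pattern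
    for \<open>x\<close> alone, because the pair of \<open>x'\<close> and \<open>h\<close> is not in
    that star, and symmetrically.\<close>
  define g where "g = (\<lambda>e. if e = edge x h \<or> e = edge x' h then q e else 1 - q e)"
  have ne: "edge x x' \<noteq> edge x h" "edge x x' \<noteq> edge x' h"
    using x edge_eq_iff[of x' x h] edge_commute[of x x'] by (auto simp: edge_eq_iff)
  have d1: "edge x' h \<notin> star n x" "edge x h \<notin> star n x'"
    using x by (auto simp: star_def edge_def min_def max_def split: if_splits)
  have "{F. is_leaf (graph_adj n F) h x} \<inter> {F. is_leaf (graph_adj n F) h x'}
     = {F. \<forall>e\<in>star n x \<union> star n x'. F e = (e = edge x h \<or> e = edge x' h)}"
    using d1 x by (auto simp: is_leaf_iff_star)
  then have "measure_pmf.prob (edge_pmf n q)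
        ({F. is_leaf (graph_adj n F) h x} \<inter> {F. is_leaf (graph_adj n F) h x'}) * (1 - q (edge x x'))
      = prod g (star n x \<union> star n x') * prod g (star n x \<inter> star n x')"
    using x ne prob_edge_pmf_restrict[where q=q and A="star n x \<union> star n x'" and n=n, OF q] star_subset
    by (simp add: star_Int_star g_def)
  also have "\<dots> = prod g (star n x) * prod g (star n x')"
    by (rule prod.union_inter) auto
  also have "prod g (star n x) = (\<Prod>e\<in>star n x. if e = edge x h then q e else 1 - q e)"
    using d1 by (intro prod.cong) (auto simp: g_def)
  also have "prod g (star n x') = (\<Prod>e\<in>star n x'. if e = edge x' h then q e else 1 - q e)"
    using d1 by (intro prod.cong) (auto simp: g_def)
  finally show ?thesis using prob_leaf[OF q] x by simp
qed

text \<open>Leaves at the same hub are nearly uncorrelated: by \<open>prob_two_leaves\<close> the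
  correlation factor is 1/(1 - r) with r the probability of the pair joining them, and r \<le> 1/2
  gives 1/(1 - r) \<le> 1 + 2r \<le> 1 + \<tau>.\<close>

lemma prob_few_leaves:
  assumes q: "\<And>e. 0 \<le> q e \<and> q e \<le> 1"
    and B: "B \<subseteq> {..<n}" "B \<noteq> {}" "h \<notin> B" "h < n"
    and half: "\<And>x y. x \<in> B \<Longrightarrow> y < n \<Longrightarrow> y \<noteq> x \<Longrightarrow> q (edge x y) \<le> 1/2"
    and deg: "\<And>x. x \<in> B \<Longrightarrow> (\<Sum>y\<in>{..<n} - {x}. q (edge x y)) \<le> D"
    and s: "0 < s" "\<And>x. x \<in> B \<Longrightarrow> s \<le> q (edge x h)"
    and \<tau>: "0 \<le> \<tau>" "\<And>x x'. x \<in> B \<Longrightarrow> x' \<in> B \<Longrightarrow> x \<noteq> x' \<Longrightarrow> 2 * q (edge x x') \<le> \<tau>"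
    and m: "0 < m" "m \<le> card B * (s * exp (- 2 * D))"
  shows "measure_pmf.prob (edge_pmf n q) {F. real (card {x \<in> B. is_leaf (graph_adj n F) h x}) < m / 2}
      \<le> 4 * (1 / m + \<tau>)"
proof -
  define P where "P = measure_pmf.prob (edge_pmf n q)"
  define L where "L = (\<lambda>x. {F. is_leaf (graph_adj n F) h x})"
  have finB: "finite B" using B(1) finite_subset by auto
  have "P (L x \<inter> L x') \<le> (1 + \<tau>) * (P (L x) * P (L x'))" if x: "x \<in> B" "x' \<in> B" "x \<noteq> x'" for x x'
  proof -
    define r where "r = q (edge x x')"
    have xn: "x < n" "x' < n" "h \<noteq> x" "h \<noteq> x'" using x B by auto
    have r: "0 \<le> r" "r \<le> 1/2" "2 * r \<le> \<tau>"
      using q half[of x x'] \<tau>(2)[OF x] x xn by (auto simp: r_def)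
    have "1 \<le> (1 - r) * (1 + 2 * r)" using r mult_left_mono[of "2 * r" 1 r] by (simp add: algebra_simps)
    also have "\<dots> \<le> (1 - r) * (1 + \<tau>)" using r by (intro mult_left_mono) auto
    finally have "P (L x \<inter> L x') * 1 \<le> P (L x \<inter> L x') * ((1 - r) * (1 + \<tau>))"
      by (intro mult_left_mono) (auto simp: P_def)
    also have "\<dots> = (1 + \<tau>) * (P (L x) * P (L x'))"
      using prob_two_leaves[where q=q and x=x and x'=x' and n=n and h=h, OF q] xn B x by (simp add: P_def L_def r_def)
    finally show ?thesis by simp
  qed
  moreover have "m \<le> (\<Sum>x\<in>B. P (L x))"
  proof -
    have "s * exp (- 2 * D) \<le> P (L x)" if "x \<in> B" for x
    proof -
      have "s * exp (- 2 * D) \<le> q (edge x h) * exp (- 2 * D)" using s that by simp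
      also have "\<dots> \<le> P (L x)"
        unfolding P_def L_def using that B half deg by (intro prob_leaf_ge[OF q]) auto
      finally show ?thesis .
    qed
    then show ?thesis using m(2) sum_bounded_below[of B "s * exp (- 2 * D)" "\<lambda>x. P (L x)"] by simp
  qed
  ultimately have "measure_pmf.prob (edge_pmf n q)
     {F \<in> space (measure_pmf (edge_pmf n q)). real (card {x \<in> B. F \<in> L x}) < m / 2} \<le> 4 * (1 / m + \<tau>)"
    unfolding P_def using finB \<tau>(1) m(1) by (intro measure_pmf.second_moment_events) auto
  then show ?thesis by (simp add: L_def)
qed

section \<open>Lower bounds for fixed edge probabilities\<close>

text \<open>\<open>H\<close> are the hubs and \<open>B\<close> the potential leaves: \<open>D\<close> bounds the expected degree on \<open>B\<close>, \<open>s\<close> the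
  probability of an edge between \<open>B\<close> and \<open>H\<close> from below, \<open>\<tau>\<close> the correlation of two leaves,
  \<open>\<mu>\<close> the expected number of leaves of a hub from below, and \<open>\<eta>\<close> the distance of the edge
  probabilities on \<open>H\<close> from 0 and 1.\<close>
locale hub_graph =
  fixes n :: nat and q :: "nat \<times> nat \<Rightarrow> real" and H B :: "nat set" and k :: nat
    and s D \<tau> \<eta> \<mu> :: real
  assumes q: "\<And>e. 0 \<le> q e \<and> q e \<le> 1"
    and H: "H \<subseteq> {..<n}" "card H = k" and B: "B \<subseteq> {..<n}" "B \<inter> H = {}" "B \<noteq> {}"
    and half: "\<And>x y. x \<in> B \<Longrightarrow> y < n \<Longrightarrow> y \<noteq> x \<Longrightarrow> q (edge x y) \<le> 1/2"
    and deg: "\<And>x. x \<in> B \<Longrightarrow> (\<Sum>y\<in>{..<n} - {x}. q (edge x y)) \<le> D"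
    and s: "0 < s" "\<And>x h. x \<in> B \<Longrightarrow> h \<in> H \<Longrightarrow> s \<le> q (edge x h)"
    and \<tau>: "0 \<le> \<tau>" "\<And>x x'. x \<in> B \<Longrightarrow> x' \<in> B \<Longrightarrow> x \<noteq> x' \<Longrightarrow> 2 * q (edge x x') \<le> \<tau>"
    and \<mu>: "0 < \<mu>" "\<mu> \<le> card B * (s * exp (- 2 * D))"
    and \<eta>: "0 < \<eta>" "\<And>e. e \<in> pairs_in H \<Longrightarrow> \<eta> \<le> q e \<and> q e \<le> 1/2"
    and k: "2 \<le> k" "16 \<le> \<eta> * k"
begin

abbreviation P where "P \<equiv> measure_pmf.prob (edge_pmf n q)"

text \<open>Half the expected number of leaves, the level guaranteed by the second moment bound;
  rounding up is harmless because leaf counts are integers.\<close>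

definition rows :: nat where "rows = nat \<lceil>\<mu> / 2\<rceil>"

definition has_array :: "(nat \<times> nat \<Rightarrow> bool) \<Rightarrow> bool" where
  "has_array F \<longleftrightarrow> (\<exists>l. leaf_array n (graph_adj n F) H rows l)"

lemma finite_H: "finite H"
  using H(1) finite_subset by blast

lemma card_pairs_H: "real (card (pairs_in H)) = (real k ^ 2 - k) / 2"
proof -
  have "real (2 * card (pairs_in H) + k) = real (k ^ 2)"
    using card_pairs_in[OF finite_H] H(2) by (intro arg_cong[of _ _ real]) simp
  then show ?thesis by simp
qed

lemma pairs_H: "pairs_in H \<subseteq> vpairs n" "pairs_in H \<noteq> {}" "(real k)\<^sup>2 / 4 \<le> card (pairs_in H)"
proof -
  show "pairs_in H \<subseteq> vpairs n" using pairs_in_subset_vpairs[OF H(1)] .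
  have "2 * real k \<le> (real k)\<^sup>2" using k(1) by (simp add: power2_eq_square)
  then show *: "(real k)\<^sup>2 / 4 \<le> card (pairs_in H)" by (simp add: card_pairs_H)
  show "pairs_in H \<noteq> {}"
  proof
    assume "pairs_in H = {}"
    then have "real k = 0" using * by simp
    then show False using k by simp
  qed
qed

lemma eta_le: "\<eta> \<le> 1/2"
  using \<eta>(2) pairs_H(2) by force

text \<open>A union bound over the \<open>k\<close> hubs, each of which must have
  \<open>rows\<close> leaves; it is useful only when k/\<mu> and k * \<tau> are small.\<close>

lemma prob_no_array: "P {F. \<not> has_array F} \<le> k * (4 * (1 / \<mu> + \<tau>))"
proof -
  have "P {F. \<not> has_array F}
      \<le> P (\<Union>h\<in>H. {F. real (card {x \<in> B. is_leaf (graph_adj n F) h x}) < \<mu> / 2})"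
  proof (rule measure_pmf.finite_measure_mono)
    show "{F. \<not> has_array F} \<subseteq> (\<Union>h\<in>H. {F. real (card {x \<in> B. is_leaf (graph_adj n F) h x}) < \<mu> / 2})"
    proof (rule subsetI, rule ccontr)
      fix F assume F: "F \<in> {F. \<not> has_array F}"
        "F \<notin> (\<Union>h\<in>H. {F. real (card {x \<in> B. is_leaf (graph_adj n F) h x}) < \<mu> / 2})"
      then have "rows \<le> card {x \<in> B. is_leaf (graph_adj n F) h x}" if "h \<in> H" for h
        using that by (auto simp: rows_def not_less nat_le_iff ceiling_le_iff)
      then have "has_array F" unfolding has_array_def using B by (intro ex_leaf_array) auto
      then show False using F by simp
    qed
  qed simp
  also have "\<dots> \<le> (\<Sum>h\<in>H. P {F. real (card {x \<in> B. is_leaf (graph_adj n F) h x}) < \<mu> / 2})"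
    using finite_H by (intro measure_pmf.finite_measure_subadditive_finite) auto
  also have "\<dots> \<le> (\<Sum>h\<in>H. 4 * (1 / \<mu> + \<tau>))"
    using H(1) B s \<tau> \<mu> half deg by (intro sum_mono prob_few_leaves[OF q]) auto
  finally show ?thesis by (simp add: H(2))
qed

lemma rows_ge: "\<mu> / 2 \<le> rows"
  unfolding rows_def by linarith

text \<open>The 1/16 is 1/2 from \<open>rows\<close> times 1/8 from \<open>T\<close>. A short
  labeling means that either the leaf array is missing or the hub graph is one of the few that the
  decoder can produce from label families of total length at most \<open>T\<close>.\<close>

lemma prob_short_labeling:
  fixes Dec :: "bool list \<Rightarrow> bool list \<Rightarrow> enat"
  shows "P {F. \<not> (\<forall>Lab. is_distance_labeling n (graph_adj n F) Dec Lab \<longrightarrow>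
        \<mu> * \<eta> * k\<^sup>2 / 16 \<le> labeling_length n Lab)}
    \<le> k * (4 * (1 / \<mu> + \<tau>)) + 16 / (\<eta> * k\<^sup>2)"
proof -
  \<comment> \<open>At this \<open>T\<close> there are at most exp (\<eta>k^2/4 + k) label families,
    while a single hub graph has probability at most exp (-\<eta>k^2/2 + \<eta>k/2); a margin of
    \<eta>k^2/4 remains in the exponent.\<close>
  define T where "T = nat \<lfloor>\<eta> * k\<^sup>2 / 8\<rfloor>"
  define S where "S = {lab \<in> H \<rightarrow>\<^sub>E (UNIV :: bool list set). (\<Sum>h\<in>H. length (lab h)) \<le> T}"
  \<comment> \<open>The hub graph decoded from \<open>lab\<close>. The image of \<open>S\<close>
    under \<open>\<phi>\<close> involves neither the graph nor the leaves, which is what makes a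
    union bound over it legitimate.\<close>
  define \<phi> where "\<phi> = (\<lambda>lab (e :: nat \<times> nat). Dec (lab (fst e)) (lab (snd e)) = 3)"
  define Bad where "Bad = {F. \<exists>Lab. is_distance_labeling n (graph_adj n F) Dec Lab \<and>
        labeling_length n Lab < \<mu> * \<eta> * k\<^sup>2 / 16}"
  note S = card_short_labelings[OF finite_H, of T, folded S_def]
  have T: "real T \<le> \<eta> * k\<^sup>2 / 8" "\<eta> * k\<^sup>2 / 8 \<le> Suc T"
    using \<eta>(1) by (auto simp: T_def) linarith+
  have sub: "Bad \<subseteq> {F. \<not> has_array F} \<union> {F. \<exists>a\<in>\<phi> ` S. \<forall>e\<in>pairs_in H. F e = a e}"
  proof
    fix F assume "F \<in> Bad"
    then obtain Lab where Lab: "is_distance_labeling n (graph_adj n F) Dec Lab"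
      and len: "labeling_length n Lab < \<mu> * \<eta> * k\<^sup>2 / 16" by (auto simp: Bad_def)
    show "F \<in> {F. \<not> has_array F} \<union> {F. \<exists>a\<in>\<phi> ` S. \<forall>e\<in>pairs_in H. F e = a e}"
    proof (cases "has_array F")
      case True
      then obtain l where l: "leaf_array n (graph_adj n F) H rows l" by (auto simp: has_array_def)
      have "\<mu> / 2 * (\<eta> * k\<^sup>2 / 8) \<le> real rows * Suc T"
        using rows_ge T(2) \<mu>(1) \<eta>(1) by (intro mult_mono) auto
      then have "real (labeling_length n Lab) < real (rows * Suc T)"
        using len by (simp only: of_nat_mult)
      then have "labeling_length n Lab < rows * Suc T" by linarith
      from short_labeling_determines_hub_graph[OF l finite_H graph_adj_sym Lab this, folded S_def]
      obtain lab where lab: "lab \<in> S"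
        "\<And>h h'. h \<in> H \<Longrightarrow> h' \<in> H \<Longrightarrow> h \<noteq> h' \<Longrightarrow> graph_adj n F h h' \<longleftrightarrow> Dec (lab h) (lab h') = 3"
        by blast
      have "F e = \<phi> lab e" if "e \<in> pairs_in H" for e
        using that lab(2)[of "fst e" "snd e"] H(1) edge_fst_snd[of e]
        by (auto simp: \<phi>_def pairs_in_def graph_adj_def)
      then show ?thesis using lab(1) by blast
    qed simp
  qed
  have "P {F. \<exists>a\<in>\<phi> ` S. \<forall>e\<in>pairs_in H. F e = a e} \<le> real (card (\<phi> ` S)) * (1 - \<eta>) ^ card (pairs_in H)"
  proof (rule prob_hub_graph_in_small_set[OF q pairs_H(1)])
    show "\<eta> \<le> q e \<and> q e \<le> 1 - \<eta>" if "e \<in> pairs_in H" for e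
      using \<eta>(2)[OF that] eta_le by auto
  qed (use S in auto)
  also have "\<dots> \<le> (4 ^ T * 2 ^ k) * (1 - \<eta>) ^ card (pairs_in H)"
    using S card_image_le[OF S(1), of \<phi>] eta_le H(2) by (intro mult_right_mono) auto
  also have "\<dots> \<le> (exp (2 * (\<eta> * k\<^sup>2 / 8)) * exp k) * exp (- \<eta> * card (pairs_in H))"
  proof (intro mult_mono)
    have e2: "(2::real) \<le> exp 1" using exp_ge_add_one_self[of 1] by simp
    then have "(4::real) \<le> exp 2" using mult_mono[OF e2 e2] by (simp flip: exp_add)
    then have "(4::real) ^ T \<le> exp 2 ^ T" by (intro power_mono) auto
    also have "\<dots> = exp (2 * real T)" by (simp add: exp_of_nat_mult[symmetric] mult.commute)
    also have "\<dots> \<le> exp (2 * (\<eta> * k\<^sup>2 / 8))" using T(1) by simp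
    finally show "(4::real) ^ T \<le> exp (2 * (\<eta> * k\<^sup>2 / 8))" .
    have "(2::real) ^ k \<le> exp 1 ^ k" using e2 by (intro power_mono) auto
    then show "(2::real) ^ k \<le> exp k" by (simp add: exp_of_nat_mult[symmetric])
    have "(1 - \<eta>) ^ card (pairs_in H) \<le> exp (- \<eta>) ^ card (pairs_in H)"
      using eta_le exp_ge_add_one_self[of "- \<eta>"] by (intro power_mono) auto
    then show "(1 - \<eta>) ^ card (pairs_in H) \<le> exp (- \<eta> * card (pairs_in H))"
      by (simp add: exp_of_nat_mult[symmetric] mult.commute)
  qed (use eta_le in auto)
  also have "\<dots> = exp (- \<eta> * k\<^sup>2 / 4 + k + \<eta> * k / 2)"
    unfolding card_pairs_H exp_add[symmetric] by (rule arg_cong[of _ _ exp]) (simp add: field_simps)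
  also have "\<dots> \<le> exp (- (\<eta> * k\<^sup>2 / 8))"
  proof -
    \<comment> \<open>The linear terms k + \<eta>k/2 are at most 2k, hence at most half of the
      margin \<eta>k^2/4.\<close>
    have "16 * real k \<le> \<eta> * k\<^sup>2"
      using mult_right_mono[OF k(2), of "real k"] by (simp add: power2_eq_square algebra_simps)
    moreover have "\<eta> * k \<le> 1 * real k" using eta_le by (intro mult_right_mono) auto
    ultimately show ?thesis by simp
  qed
  \<comment> \<open>The exponential decay is weakened to the rate available for 2-hop covers, so
    that both results share one error term.\<close>
  also have "\<dots> \<le> 16 / (\<eta> * k\<^sup>2)"
  proof -
    have pos: "0 < \<eta> * k\<^sup>2" using \<eta>(1) k by simp
    have "\<eta> * k\<^sup>2 / 8 \<le> exp (\<eta> * k\<^sup>2 / 8)" using exp_ge_add_one_self[of "\<eta> * k\<^sup>2 / 8"] by linarith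
    then have "inverse (exp (\<eta> * k\<^sup>2 / 8)) \<le> inverse (\<eta> * k\<^sup>2 / 8)"
      using pos by (intro le_imp_inverse_le) auto
    also have "\<dots> \<le> 16 / (\<eta> * k\<^sup>2)" using pos by (simp add: field_simps)
    finally show ?thesis by (simp add: exp_minus)
  qed
  finally have "P {F. \<exists>a\<in>\<phi> ` S. \<forall>e\<in>pairs_in H. F e = a e} \<le> 16 / (\<eta> * k\<^sup>2)" .
  then have "P Bad \<le> k * (4 * (1 / \<mu> + \<tau>)) + 16 / (\<eta> * k\<^sup>2)"
    using measure_pmf.finite_measure_mono[OF sub, of "edge_pmf n q"] prob_no_array
      measure_Un_le[of "{F. \<not> has_array F}" "measure_pmf (edge_pmf n q)" "{F. \<exists>a\<in>\<phi> ` S. \<forall>e\<in>pairs_in H. F e = a e}"]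
    by simp
  then show ?thesis by (simp add: Bad_def not_le)
qed

text \<open>The charging argument pays one landmark per row and hub edge: at least \<mu>/2 rows and
  \<eta>N/2 edges with N \<ge> k^2/4, which again multiplies to \<mu>\<eta>k^2/16.\<close>

lemma prob_small_2hop_cover:
  "P {F. \<not> (\<forall>L. is_2hop_cover n (graph_adj n F) L \<longrightarrow>
        \<mu> * \<eta> * k\<^sup>2 / 16 \<le> num_landmarks n L)}
    \<le> k * (4 * (1 / \<mu> + \<tau>)) + 16 / (\<eta> * k\<^sup>2)"
proof -
  define N where "N = card (pairs_in H)"
  define Few where "Few = {F. real (card {e \<in> pairs_in H. F e}) < \<eta> * N / 2}"
  define Bad where "Bad = {F. \<exists>L. is_2hop_cover n (graph_adj n F) L \<and>
        num_landmarks n L < \<mu> * \<eta> * k\<^sup>2 / 16}"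
  have N: "0 < (real k)\<^sup>2" "(real k)\<^sup>2 \<le> 4 * N" using pairs_H(3) k by (auto simp: N_def)
  have sub: "Bad \<subseteq> {F. \<not> has_array F} \<union> Few"
  proof
    fix F assume "F \<in> Bad"
    then obtain L where L: "is_2hop_cover n (graph_adj n F) L"
      and num: "num_landmarks n L < \<mu> * \<eta> * k\<^sup>2 / 16" by (auto simp: Bad_def)
    show "F \<in> {F. \<not> has_array F} \<union> Few"
    proof (rule ccontr)
      assume F: "F \<notin> {F. \<not> has_array F} \<union> Few"
      then obtain l where l: "leaf_array n (graph_adj n F) H rows l" by (auto simp: has_array_def)
      have eq: "{e \<in> pairs_in H. graph_adj n F (fst e) (snd e)} = {e \<in> pairs_in H. F e}"
        using H(1) edge_fst_snd by (auto simp: pairs_in_def graph_adj_def)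
      have "real (rows * card {e \<in> pairs_in H. F e}) \<le> num_landmarks n L"
        using two_hop_cover_charges_hub_edges[OF l finite_H graph_adj_sym L] by (simp add: eq del: of_nat_mult)
      moreover have "\<mu> / 2 * (\<eta> * N / 2) \<le> real rows * real (card {e \<in> pairs_in H. F e})"
        using F rows_ge \<mu>(1) \<eta>(1) by (intro mult_mono) (auto simp: Few_def)
      moreover have "\<mu> * \<eta> * k\<^sup>2 \<le> \<mu> * \<eta> * (4 * N)" using N \<mu>(1) \<eta>(1) by (intro mult_left_mono) auto
      ultimately show False using num by simp
    qed
  qed
  have "P Few \<le> 4 / (\<eta> * N)"
    unfolding Few_def N_def using prob_few_hub_edges[OF q pairs_H(1,2) \<eta>(1)] \<eta>(2) by simp
  also have "\<dots> \<le> 16 / (\<eta> * k\<^sup>2)"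
  proof -
    have "0 < real N" using N by linarith
    then have "4 / (\<eta> * N) = 16 / (\<eta> * (4 * N))" by simp
    also have "\<dots> \<le> 16 / (\<eta> * k\<^sup>2)"
      using N \<eta>(1) \<open>0 < real N\<close> by (intro divide_left_mono mult_left_mono mult_pos_pos) auto
    finally show ?thesis .
  qed
  finally have "P Bad \<le> k * (4 * (1 / \<mu> + \<tau>)) + 16 / (\<eta> * k\<^sup>2)"
    using measure_pmf.finite_measure_mono[OF sub, of "edge_pmf n q"] prob_no_array
      measure_Un_le[of "{F. \<not> has_array F}" "measure_pmf (edge_pmf n q)" Few]
    by simp
  then show ?thesis by (simp add: Bad_def not_le)
qed
end

section \<open>Power law weights\<close>

abbreviation uniform01 :: "real measure" where
  "uniform01 \<equiv> uniform_measure lborel {0..1}"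

lemma prob_space_uniform01: "prob_space uniform01"
  by (rule prob_space_uniform_measure) auto

lemma measure_uniform01:
  assumes "0 \<le> q" "q \<le> 1"
  shows "measure uniform01 {..<q} = q" "measure uniform01 {q..} = 1 - q"
proof -
  have "{0..1} \<inter> {..<q} = {0..<q}" "{0..1} \<inter> {q..} = {q..1}" using assms by auto
  then show "measure uniform01 {..<q} = q" "measure uniform01 {q..} = 1 - q"
    using assms by simp_all
qed

text \<open>The cube splits into finitely many boxes \<open>C F\<close>, one for each graph, and the
  volume of a box is the product of the Bernoulli probabilities. An arbitrary predicate
  \<open>Q\<close> is allowed since it merely selects boxes.\<close>

lemma uniform01_threshold_eq_edge_pmf:
  fixes q :: "nat \<times> nat \<Rightarrow> real" and n :: nat
  assumes q: "\<And>e. 0 \<le> q e \<and> q e \<le> 1"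
  defines "U \<equiv> PiM (vpairs n) (\<lambda>_. uniform01)"
  shows "measure U {u \<in> space U. Q (\<lambda>e. e \<in> vpairs n \<and> u e < q e)}
       = measure_pmf.prob (edge_pmf n q) {F. Q F}"
proof -
  interpret U: finite_product_prob_space "\<lambda>_. uniform01" "vpairs n"
    by (intro finite_product_prob_space.intro product_prob_space.intro product_sigma_finite.intro
        product_prob_space_axioms.intro finite_product_sigma_finite.intro
        finite_product_sigma_finite_axioms.intro prob_space_uniform01
        prob_space_imp_sigma_finite) auto
  define \<F> where "\<F> = {F. (\<forall>e. F e \<longrightarrow> e \<in> vpairs n) \<and> Q F}"
  define C where "C = (\<lambda>F. PiE (vpairs n) (\<lambda>e. if F e then {..<q e} else {q e..}))"
  have "finite {F :: nat \<times> nat \<Rightarrow> bool. Collect F \<subseteq> vpairs n}"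
    by (rule finite_imageD[of Collect]) (auto intro!: finite_subset[of _ "Pow (vpairs n)"] simp: inj_on_def)
  then have fin: "finite \<F>" by (rule rev_finite_subset) (auto simp: \<F>_def)
  have C_iff: "u \<in> C F \<longleftrightarrow> u \<in> space U \<and> F = (\<lambda>e. e \<in> vpairs n \<and> u e < q e)"
    if "F \<in> \<F>" for F u
    using that by (auto simp: C_def U_def space_PiM PiE_iff \<F>_def fun_eq_iff not_less split: if_splits)
  have set_eq: "{u \<in> space U. Q (\<lambda>e. e \<in> vpairs n \<and> u e < q e)} = (\<Union>F\<in>\<F>. C F)"
    using C_iff by (force simp: \<F>_def)
  have C_sets: "C F \<in> sets U" for F
    unfolding C_def U_def by (intro sets_PiM_I_finite) auto
  have "measure U {u \<in> space U. Q (\<lambda>e. e \<in> vpairs n \<and> u e < q e)} = (\<Sum>F\<in>\<F>. measure U (C F))"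
    unfolding set_eq
  proof (rule U.finite_measure_finite_Union[folded U_def])
    show "disjoint_family_on C \<F>" using C_iff by (auto simp: disjoint_family_on_def)
  qed (use fin C_sets in auto)
  also have "\<dots> = (\<Sum>F\<in>\<F>. pmf (edge_pmf n q) F)"
  proof (rule sum.cong[OF refl])
    fix F assume F: "F \<in> \<F>"
    have "measure U (C F) = (\<Prod>e\<in>vpairs n. measure uniform01 (if F e then {..<q e} else {q e..}))"
      unfolding U_def C_def by (rule U.finite_measure_PiM_emb) auto
    also have "\<dots> = (\<Prod>e\<in>vpairs n. pmf (bernoulli_pmf (q e)) (F e))"
      using q measure_uniform01 by (intro prod.cong) auto
    also have "\<dots> = pmf (edge_pmf n q) F"
      unfolding edge_pmf_def using F by (subst pmf_Pi') (auto simp: \<F>_def)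
    finally show "measure U (C F) = pmf (edge_pmf n q) F" .
  qed
  also have "\<dots> = measure_pmf.prob (edge_pmf n q) \<F>"
    using fin by (simp add: measure_measure_pmf_finite)
  \<comment> \<open>Indicators that are true outside \<open>vpairs n\<close> are missing from
    \<open>\<F>\<close>, but they have mass 0.\<close>
  also have "\<dots> = measure_pmf.prob (edge_pmf n q) {F. Q F}"
    unfolding edge_pmf_def
    by (intro measure_prob_cong_0) (auto simp: \<F>_def intro!: pmf_Pi_outside)
  finally show "measure U {u \<in> space U. Q (\<lambda>e. e \<in> vpairs n \<and> u e < q e)}
       = measure_pmf.prob (edge_pmf n q) {F. Q F}" .
qed

section \<open>Tails and moments of the power law\<close>

text \<open>One integral for two purposes: s = 0 gives the tail, and a = \<open>xmin\<close> gives
  the finite moments. The antiderivative vanishes at infinity because s - \<beta> + 1 is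
  negative.\<close>

lemma nn_integral_powr_pl_weight:
  assumes "0 < xmin" "xmin \<le> a" "s < \<beta> - 1" "1 < \<beta>"
  shows "(\<integral>\<^sup>+t. ennreal (t powr s) * indicator {a..} t \<partial>pl_weight_measure xmin \<beta>)
     = ennreal ((\<beta> - 1) * xmin powr (\<beta> - 1) * a powr (s - \<beta> + 1) / (\<beta> - 1 - s))"
proof -
  define Z where "Z = (\<beta> - 1) * xmin powr (\<beta> - 1)"
  have Z: "0 \<le> Z" using assms by (simp add: Z_def)
  have [measurable]: "pl_density xmin \<beta> \<in> borel_measurable borel"
    unfolding pl_density_def by measurable
  have "(\<integral>\<^sup>+t. ennreal (t powr s) * indicator {a..} t \<partial>pl_weight_measure xmin \<beta>)
     = (\<integral>\<^sup>+t. ennreal (Z * t powr (s - \<beta>)) * indicator {a..} t \<partial>lborel)"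
    unfolding pl_weight_measure_def
    using assms Z by (subst nn_integral_density)
      (auto intro!: nn_integral_cong simp: pl_density_def Z_def indicator_def powr_diff powr_minus_divide
        simp flip: ennreal_mult' split: if_splits)
  also have "\<dots> = ennreal (0 - (- Z * a powr (s - \<beta> + 1) / (\<beta> - 1 - s)))"
  proof (rule nn_integral_FTC_atLeast)
    show "((\<lambda>t. - Z * t powr (s - \<beta> + 1) / (\<beta> - 1 - s)) has_real_derivative Z * t powr (s - \<beta>)) (at t)"
      if "a \<le> t" for t
    proof -
      define b where "b = \<beta> - 1 - s"
      have b: "b \<noteq> 0" "s - \<beta> + 1 = - b" "s - \<beta> = - b - 1" using assms by (auto simp: b_def)
      have "((\<lambda>t. (- Z / b) * t powr (- b)) has_real_derivative (- Z / b) * (- b * t powr (- b - 1))) (at t)"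
        using that assms by (intro DERIV_cmult has_real_derivative_powr) auto
      then show ?thesis using b by (simp flip: b_def)
    qed
    have "((\<lambda>t. t powr (s - \<beta> + 1)) \<longlongrightarrow> 0) at_top"
      using assms by (intro tendsto_neg_powr filterlim_ident) auto
    then have "((\<lambda>t. - Z / (\<beta> - 1 - s) * t powr (s - \<beta> + 1)) \<longlongrightarrow> - Z / (\<beta> - 1 - s) * 0) at_top"
      by (intro tendsto_intros)
    then show "((\<lambda>t. - Z * t powr (s - \<beta> + 1) / (\<beta> - 1 - s)) \<longlongrightarrow> 0) at_top" by simp
  qed (use Z in auto)
  finally show ?thesis by (simp add: Z_def)
qed

lemma sets_pl_weight_measure [measurable_cong, simp]: "sets (pl_weight_measure xmin \<beta>) = sets borel"
  by (simp add: pl_weight_measure_def)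

lemma space_pl_weight_measure [simp]: "space (pl_weight_measure xmin \<beta>) = UNIV"
  by (simp add: pl_weight_measure_def)

lemma AE_pl_weight_ge:
  "AE t in pl_weight_measure xmin \<beta>. xmin \<le> t"
proof -
  have [measurable]: "pl_density xmin \<beta> \<in> borel_measurable borel"
    unfolding pl_density_def by measurable
  show ?thesis
    unfolding pl_weight_measure_def by (subst AE_density) (auto simp: pl_density_def split: if_splits)
qed

lemma emeasure_pl_weight_atLeast:
  assumes "0 < xmin" "xmin \<le> a" "1 < \<beta>"
  shows "emeasure (pl_weight_measure xmin \<beta>) {a..} = ennreal ((xmin / a) powr (\<beta> - 1))"
proof -
  have "emeasure (pl_weight_measure xmin \<beta>) {a..}
      = (\<integral>\<^sup>+t. ennreal (t powr 0) * indicator {a..} t \<partial>pl_weight_measure xmin \<beta>)"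
  proof -
    have "(\<integral>\<^sup>+t. ennreal (t powr 0) * indicator {a..} t \<partial>pl_weight_measure xmin \<beta>)
        = (\<integral>\<^sup>+t. indicator {a..} t \<partial>pl_weight_measure xmin \<beta>)"
      using assms by (intro nn_integral_cong) (auto simp: indicator_def)
    then show ?thesis by simp
  qed
  also have "\<dots> = ennreal ((xmin / a) powr (\<beta> - 1))"
    using assms by (subst nn_integral_powr_pl_weight)
      (auto simp: powr_divide powr_diff powr_add powr_minus field_simps)
  finally show ?thesis .
qed

lemma prob_space_pl_weight:
  assumes "0 < xmin" "1 < \<beta>"
  shows "prob_space (pl_weight_measure xmin \<beta>)"
proof
  have "emeasure (pl_weight_measure xmin \<beta>) (space (pl_weight_measure xmin \<beta>))
      = emeasure (pl_weight_measure xmin \<beta>) {xmin..}"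
    using AE_pl_weight_ge[of xmin \<beta>] by (intro emeasure_eq_AE) auto
  then show "emeasure (pl_weight_measure xmin \<beta>) (space (pl_weight_measure xmin \<beta>)) = 1"
    using emeasure_pl_weight_atLeast[of xmin xmin \<beta>] assms by simp
qed

lemma measure_pl_weight_atLeast:
  assumes "0 < xmin" "xmin \<le> a" "1 < \<beta>"
  shows "measure (pl_weight_measure xmin \<beta>) {a..} = (xmin / a) powr (\<beta> - 1)"
  using emeasure_pl_weight_atLeast[OF assms] by (simp add: measure_def)

lemma integrable_powr_pl_weight:
  assumes "0 < xmin" "1 < \<beta>" "s < \<beta> - 1"
  shows "integrable (pl_weight_measure xmin \<beta>) (\<lambda>t. t powr s)"
proof (rule integrableI_bounded)
  have "(\<integral>\<^sup>+t. ennreal (norm (t powr s)) \<partial>pl_weight_measure xmin \<beta>)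
      = (\<integral>\<^sup>+t. ennreal (t powr s) * indicator {xmin..} t \<partial>pl_weight_measure xmin \<beta>)"
    using AE_pl_weight_ge[of xmin \<beta>] by (intro nn_integral_cong_AE) auto
  then show "(\<integral>\<^sup>+t. ennreal (norm (t powr s)) \<partial>pl_weight_measure xmin \<beta>) < \<infinity>"
    using assms by (simp add: nn_integral_powr_pl_weight)
qed measurable

lemma integrable_pl_weight:
  assumes "0 < xmin" "2 < \<beta>"
  shows "integrable (pl_weight_measure xmin \<beta>) (\<lambda>t. t)"
proof -
  have "integrable (pl_weight_measure xmin \<beta>) (\<lambda>t. t powr 1)"
    using assms by (intro integrable_powr_pl_weight) auto
  then show ?thesis
    by (rule integrable_cong_AE_imp) (use AE_pl_weight_ge[of xmin \<beta>] assms in auto)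
qed

lemma borel_measurable_card_events:
  assumes "finite I" "\<And>i. i \<in> I \<Longrightarrow> A i \<in> sets M"
  shows "(\<lambda>\<omega>. real (card {i \<in> I. \<omega> \<in> A i})) \<in> borel_measurable M"
proof -
  have "(\<lambda>\<omega>. \<Sum>i\<in>I. indicat_real (A i) \<omega>) \<in> borel_measurable M"
    using assms by (intro borel_measurable_sum) auto
  then show ?thesis using assms(1) by (simp add: indicator_def sum.If_cases Int_def)
qed

section \<open>Independent weights: hubs, light vertices and volume\<close>

locale pl_weights =
  fixes xmin \<epsilon> :: real
  assumes xmin: "0 < xmin" and eps: "0 < \<epsilon>" "\<epsilon> < 1"
begin

abbreviation W where "W \<equiv> pl_weight_measure xmin (2 + \<epsilon>)"

abbreviation WW where "WW n \<equiv> PiM {..<n :: nat} (\<lambda>_. W)"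

sublocale W: prob_space W
  using xmin eps by (intro prob_space_pl_weight) auto

lemma product_W: "product_prob_space (\<lambda>_ :: nat. W)"
  by (intro product_prob_space.intro product_prob_space_axioms.intro product_sigma_finite.intro
      W.prob_space_axioms W.sigma_finite_measure_axioms)

lemma prob_space_WW: "prob_space (WW n)"
  by (intro prob_space_PiM W.prob_space_axioms)

lemma expectation_component:
  fixes f :: "real \<Rightarrow> real"
  assumes "integrable W f" "i < n"
  shows "integrable (WW n) (\<lambda>p. f (p i))" "(\<integral>p. f (p i) \<partial>WW n) = (\<integral>t. f t \<partial>W)"
proof -
  interpret P: product_prob_space "\<lambda>_. W" "{..<n}" by (rule product_W)
  have d: "distr (WW n) W (\<lambda>p. p i) = W" using assms(2) by (intro P.PiM_component) auto
  have m: "(\<lambda>p. p i) \<in> measurable (WW n) W" using assms(2) by (intro measurable_component_singleton) auto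
  show "integrable (WW n) (\<lambda>p. f (p i))"
    using assms(1) d by (intro integrable_distr[OF m, of f]) simp
  show "(\<integral>p. f (p i) \<partial>WW n) = (\<integral>t. f t \<partial>W)"
    using integral_distr[OF m borel_measurable_integrable[OF assms(1)]] d by simp
qed

lemma expectation_two_components:
  fixes f :: "real \<Rightarrow> real"
  assumes f: "integrable W f" and ij: "i < n" "j < n" "i \<noteq> j"
  shows "integrable (WW n) (\<lambda>p. f (p i) * f (p j))"
    and "(\<integral>p. f (p i) * f (p j) \<partial>WW n) = (\<integral>t. f t \<partial>W)\<^sup>2"
proof -
  interpret P: product_prob_space "\<lambda>_. W" "{..<n}" by (rule product_W)
  \<comment> \<open>Padding with the constant 1 turns a product of two coordinates into one over all
    n, to which the product formula applies.\<close>
  define g where "g = (\<lambda>k. if k \<in> {i, j} then f else (\<lambda>_. 1))"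
  have int: "integrable W (g k)" for k using f by (simp add: g_def)
  have sub: "{i, j} \<subseteq> {..<n}" using ij by auto
  have prod2: "(\<Prod>k<n. if k \<in> {i, j} then c k else 1) = c i * c j" for c :: "nat \<Rightarrow> real"
    using sub ij(3) prod.inter_restrict[of "{..<n}" c "{i, j}"] by (simp add: Int_absorb1)
  have "(\<Prod>k<n. g k (p k)) = (\<Prod>k<n. if k \<in> {i, j} then f (p k) else 1)" for p
    by (intro prod.cong) (auto simp: g_def)
  then have prod_g: "(\<Prod>k<n. g k (p k)) = f (p i) * f (p j)" for p by (simp only: prod2)
  show "integrable (WW n) (\<lambda>p. f (p i) * f (p j))"
    using P.product_integrable_prod[of "{..<n}" g] int by (simp add: prod_g)
  have "(\<Prod>k<n. integral\<^sup>L W (g k)) = (\<Prod>k<n. if k \<in> {i, j} then integral\<^sup>L W f else 1)"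
    by (intro prod.cong) (auto simp: g_def W.prob_space[simplified])
  also have "\<dots> = (\<integral>t. f t \<partial>W)\<^sup>2" by (simp only: prod2 power2_eq_square)
  finally show "(\<integral>p. f (p i) * f (p j) \<partial>WW n) = (\<integral>t. f t \<partial>W)\<^sup>2"
    using P.product_integral_prod[of "{..<n}" g] int by (simp add: prod_g)
qed

text \<open>Serves both for hubs and for light vertices; coordinates are independent, so the
  correlation is 0.\<close>

lemma prob_few_weights_in:
  assumes A: "A \<in> sets borel" and m: "0 < m" "m \<le> real n * measure W A"
  shows "measure (WW n) {p \<in> space (WW n). real (card {i. i < n \<and> p i \<in> A}) < m / 2} \<le> 4 / m"
proof -
  interpret WW: prob_space "WW n" by (rule prob_space_WW)
  define E where "E = (\<lambda>i. {p \<in> space (WW n). p i \<in> A})"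
  have comp: "(\<lambda>p. p i) \<in> measurable (WW n) W" if "i < n" for i
    using that by (intro measurable_component_singleton) auto
  have E: "E i \<in> sets (WW n)" if "i < n" for i
    unfolding E_def using measurable_sets[OF comp[OF that], of A] A
    by (simp add: vimage_def Int_def conj_commute)
  have intA: "integrable W (indicat_real A)"
    using A by (simp add: integrable_indicator_iff W.emeasure_eq_measure)
  have ind: "indicat_real A (p i) = indicat_real (E i) p" if "p \<in> space (WW n)" for p i
    using that by (simp add: E_def indicator_def)
  have pE: "WW.prob (E i) = measure W A" if "i < n" for i
  proof -
    have "WW.prob (E i) = (\<integral>p. indicat_real (E i) p \<partial>WW n)" using E[OF that] by simp
    also have "\<dots> = (\<integral>p. indicat_real A (p i) \<partial>WW n)" by (intro Bochner_Integration.integral_cong) (auto simp: ind)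
    also have "\<dots> = measure W A" using expectation_component(2)[OF intA that] A by simp
    finally show ?thesis .
  qed
  have pEE: "WW.prob (E i \<inter> E j) = measure W A * measure W A" if "i < n" "j < n" "i \<noteq> j" for i j
  proof -
    have "WW.prob (E i \<inter> E j) = (\<integral>p. indicat_real (E i \<inter> E j) p \<partial>WW n)" using E that by simp
    also have "\<dots> = (\<integral>p. indicat_real A (p i) * indicat_real A (p j) \<partial>WW n)"
      by (intro Bochner_Integration.integral_cong) (auto simp: ind indicator_inter_arith)
    also have "\<dots> = measure W A * measure W A"
      using expectation_two_components(2)[OF intA that] A by (simp add: power2_eq_square)
    finally show ?thesis .
  qed
  have "WW.prob {p \<in> space (WW n). real (card {i \<in> {..<n}. p \<in> E i}) < m / 2} \<le> 4 * (1 / m + 0)"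
    using E pE pEE m by (intro WW.second_moment_events) auto
  moreover have "{i \<in> {..<n}. p \<in> E i} = {i. i < n \<and> p i \<in> A}" if "p \<in> space (WW n)" for p
    using that by (auto simp: E_def)
  ultimately show ?thesis by (simp cong: conj_cong)
qed

text \<open>With \<open>a\<close> = n/4 this union bound is of order n * n powr (-(1 + \<epsilon>))
  = n powr (-\<epsilon>).\<close>

lemma prob_large_weight:
  assumes "xmin \<le> a"
  shows "measure (WW n) {p \<in> space (WW n). \<exists>i<n. a \<le> p i} \<le> real n * (xmin / a) powr (1 + \<epsilon>)"
proof -
  interpret WW: prob_space "WW n" by (rule prob_space_WW)
  interpret P: product_prob_space "\<lambda>_. W" "{..<n}" by (rule product_W)
  define E where "E = (\<lambda>i. {p \<in> space (WW n). p i \<in> {a..}})"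
  have comp: "(\<lambda>p. p i) \<in> measurable (WW n) W" if "i < n" for i
    using that by (intro measurable_component_singleton) auto
  have E: "E i \<in> sets (WW n)" if "i < n" for i
    unfolding E_def using measurable_sets[OF comp[OF that], of "{a..}"]
    by (simp add: vimage_def Int_def conj_commute)
  have "WW.prob (E i) = (xmin / a) powr (1 + \<epsilon>)" if "i < n" for i
    using P.emeasure_PiM_Collect_single[of i "{a..}"] that measure_pl_weight_atLeast[of xmin a "2 + \<epsilon>"]
      xmin eps assms
    by (simp add: E_def measure_def)
  then have "(\<Sum>i<n. WW.prob (E i)) = real n * (xmin / a) powr (1 + \<epsilon>)" by simp
  moreover have "{p \<in> space (WW n). \<exists>i<n. a \<le> p i} = (\<Union>i<n. E i)" by (auto simp: E_def)
  ultimately show ?thesis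
    using WW.finite_measure_subadditive_finite[of "{..<n}" E] E by auto
qed

lemma AE_weights_ge: "AE p in WW n. \<forall>i<n. xmin \<le> p i"
proof -
  interpret P: product_prob_space "\<lambda>_. W" "{..<n}" by (rule product_W)
  have "AE p in WW n. \<forall>i\<in>{..<n}. xmin \<le> p i"
    using AE_pl_weight_ge by (intro AE_finite_allI P.AE_component) auto
  then show ?thesis by (rule eventually_mono) auto
qed

text \<open>The weights have infinite variance, so the second moment bound is applied to the weights
  truncated at level \<open>N\<close>.\<close>
lemma prob_large_volume:
  assumes "xmin \<le> N" "0 < n"
  defines "\<nu> \<equiv> \<integral>t. t \<partial>W" and "M \<equiv> \<integral>t. t powr (1 + \<epsilon> / 2) \<partial>W"
  shows "measure (WW n) {p \<in> space (WW n). 2 * \<nu> * n \<le> (\<Sum>i<n. min (p i) N)}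
     \<le> 4 * M / xmin\<^sup>2 * (N powr (1 - \<epsilon> / 2) / n)"
proof -
  interpret WW: prob_space "WW n" by (rule prob_space_WW)
  define f where "f = (\<lambda>t. min t N)"
  have int_id: "integrable W (\<lambda>t. t)" using xmin eps by (intro integrable_pl_weight) auto
  have int_M: "integrable W (\<lambda>t. t powr (1 + \<epsilon> / 2))"
    using xmin eps by (intro integrable_powr_pl_weight) auto
  have int_f: "integrable W f"
    unfolding f_def using int_id by (intro integrable_min) auto
  have ge: "AE t in W. xmin \<le> f t"
    using AE_pl_weight_ge[of xmin "2 + \<epsilon>"] assms(1) by (auto simp: f_def)
  \<comment> \<open>The exponent 2 is split as (1 - \<epsilon>/2) + (1 + \<epsilon>/2): the
    truncation level bounds the first power, and the second has a finite mean since \<epsilon>/2 <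
    \<epsilon>. For \<open>N\<close> proportional to n the error is then of order n powr
    (-\<epsilon>/2).\<close>
  have sq: "AE t in W. (f t)\<^sup>2 \<le> N powr (1 - \<epsilon> / 2) * t powr (1 + \<epsilon> / 2)"
    using AE_pl_weight_ge[of xmin "2 + \<epsilon>"]
  proof eventually_elim
    case (elim t)
    then have f0: "0 < f t" using xmin assms(1) by (simp add: f_def)
    then have "(f t)\<^sup>2 = f t powr (1 - \<epsilon> / 2) * f t powr (1 + \<epsilon> / 2)"
      by (simp flip: powr_add powr_numeral)
    also have "\<dots> \<le> N powr (1 - \<epsilon> / 2) * t powr (1 + \<epsilon> / 2)"
      using f0 eps by (intro mult_mono powr_mono2) (auto simp: f_def)
    finally show ?case .
  qed
  have int_f2: "integrable W (\<lambda>t. (f t)\<^sup>2)"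
    by (rule Bochner_Integration.integrable_bound[where f = "\<lambda>t. N powr (1 - \<epsilon> / 2) * t powr (1 + \<epsilon> / 2)"])
      (use int_M sq in \<open>auto simp: f_def\<close>)
  have f2: "(\<integral>t. (f t)\<^sup>2 \<partial>W) \<le> N powr (1 - \<epsilon> / 2) * M"
    using integral_mono_AE[OF int_f2 _ sq] int_M by (simp add: M_def)
  have f_ge: "xmin \<le> (\<integral>t. f t \<partial>W)"
    using integral_mono_AE[OF _ int_f ge] by (simp add: W.prob_space[simplified])
  have f_le: "(\<integral>t. f t \<partial>W) \<le> \<nu>"
    unfolding \<nu>_def using int_f int_id by (intro integral_mono) (auto simp: f_def)
  define \<mu> where "\<mu> = real n * (\<integral>t. f t \<partial>W)"
  have \<mu>: "0 < \<mu>" "real n * xmin \<le> \<mu>" "\<mu> \<le> \<nu> * n"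
    using f_ge f_le xmin assms(2) by (auto simp: \<mu>_def mult.commute)
  have meas: "(\<lambda>p. \<Sum>i<n. f (p i)) \<in> borel_measurable (WW n)"
    using expectation_component(1)[OF int_f] by (intro borel_measurable_sum) auto
  have "WW.prob {p \<in> space (WW n). 2 * \<nu> * n \<le> (\<Sum>i<n. min (p i) N)}
     \<le> WW.prob {p \<in> space (WW n). \<mu> / 2 \<le> \<bar>(\<Sum>i<n. f (p i)) - \<mu>\<bar>}"
    using meas \<mu> by (intro WW.finite_measure_mono) (auto simp: f_def)
  also have "\<dots> \<le> 4 * ((\<Sum>i<n. WW.expectation (\<lambda>p. (f (p i))\<^sup>2)) / \<mu>\<^sup>2 + 0)"
  proof (rule WW.second_moment)
    show "integrable (WW n) (\<lambda>p. f (p i) * f (p j))" if "i \<in> {..<n}" "j \<in> {..<n}" for i j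
      using that expectation_two_components(1)[OF int_f, of i n j] expectation_component(1)[OF int_f2, of i n]
      by (cases "i = j") (auto simp: power2_eq_square)
  qed (use expectation_component[OF int_f] expectation_two_components(2)[OF int_f] \<mu>(1) f_ge xmin
      in \<open>auto simp: \<mu>_def power2_eq_square\<close>)
  also have "(\<Sum>i<n. WW.expectation (\<lambda>p. (f (p i))\<^sup>2)) = real n * (\<integral>t. (f t)\<^sup>2 \<partial>W)"
    using expectation_component(2)[OF int_f2] by simp
  also have "4 * (real n * (\<integral>t. (f t)\<^sup>2 \<partial>W) / \<mu>\<^sup>2 + 0)
      \<le> 4 * (real n * (N powr (1 - \<epsilon> / 2) * M) / (real n * xmin)\<^sup>2 + 0)"
    using f2 \<mu> xmin assms(2)
    by (intro mult_left_mono add_right_mono frac_le power_mono mult_nonneg_nonneg)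
      (auto simp: M_def intro!: integral_nonneg_AE)
  also have "\<dots> = 4 * M / xmin\<^sup>2 * (N powr (1 - \<epsilon> / 2) / n)"
    using assms(2) by (simp add: power2_eq_square field_simps)
  finally show ?thesis .
qed

abbreviation mean where "mean \<equiv> \<integral>t. t \<partial>W"

text \<open>The factor 1/8 makes the edge probability of two hubs at most 1/2.\<close>
definition hub_scale :: real where "hub_scale = sqrt (xmin / 8)"

text \<open>By \<open>measure_hub_ge\<close> the expected number of hubs is at least twice this
  constant times n powr ((1 - \<epsilon>) / 2); the second moment bound keeps half of that.\<close>

definition hub_const :: real where
  "hub_const = (xmin / hub_scale) powr (1 + \<epsilon>) / 4"

text \<open>The upper cut-off keeps the edge probability of two hubs away from 1.\<close>

definition hubs :: "nat \<Rightarrow> (nat \<Rightarrow> real) \<Rightarrow> nat set" where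
  "hubs n p = {i. i < n \<and> hub_scale * sqrt n \<le> p i \<and> p i < 2 * (hub_scale * sqrt n)}"

definition light :: "nat \<Rightarrow> (nat \<Rightarrow> real) \<Rightarrow> nat set" where
  "light n p = {i. i < n \<and> p i < 2 * xmin}"

text \<open>The cap n/4 makes every edge probability at a light vertex at most 1/2: the product of
  weights is at most 2 * \<open>xmin\<close> * n/4 and the volume at least \<open>xmin\<close> * n.
  The bound n/4 on the light vertices is half of n/2, their least expected number.\<close>

definition good_weights :: "nat \<Rightarrow> (nat \<Rightarrow> real) \<Rightarrow> bool" where
  "good_weights n p \<longleftrightarrow> (\<forall>i<n. xmin \<le> p i \<and> p i \<le> n / 4) \<and> (\<Sum>i<n. p i) \<le> 2 * mean * n \<and>
     n / 4 \<le> card (light n p) \<and> hub_const * n powr ((1 - \<epsilon>) / 2) \<le> card (hubs n p)"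

lemma hub_scale_pos: "0 < hub_scale"
  using xmin by (simp add: hub_scale_def)

lemma hub_const_pos: "0 < hub_const"
  using xmin hub_scale_pos by (simp add: hub_const_def)

lemma measure_light_ge: "1/2 \<le> measure W {..<2 * xmin}"
proof -
  have "measure W {2 * xmin..} = (1/2) powr (1 + \<epsilon>)"
    using measure_pl_weight_atLeast[of xmin "2 * xmin" "2 + \<epsilon>"] xmin eps by simp
  also have "\<dots> \<le> (1/2) powr 1" using eps by (intro powr_mono') auto
  finally show ?thesis
    using W.prob_compl[of "{2 * xmin..}"] by (simp flip: Compl_eq_Diff_UNIV)
qed

text \<open>Doubling the threshold divides the tail by 2 powr (1 + \<epsilon>) \<ge> 2, so at least
  half of the tail lies in the dyadic window.\<close>

lemma measure_hub_ge:
  assumes "xmin \<le> a"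
  shows "(xmin / a) powr (1 + \<epsilon>) / 2 \<le> measure W {a..<2 * a}"
proof -
  have a: "0 < a" using assms xmin by simp
  have "{a..<2 * a} = {a..} - {2 * a..}" using a by auto
  then have "measure W {a..<2 * a} = measure W {a..} - measure W {2 * a..}"
    using a by (simp add: W.finite_measure_Diff)
  moreover have "measure W {a..} = (xmin / a) powr (1 + \<epsilon>)"
    using measure_pl_weight_atLeast[of xmin a "2 + \<epsilon>"] assms xmin eps by simp
  moreover have "measure W {2 * a..} \<le> (xmin / a) powr (1 + \<epsilon>) / 2"
  proof -
    have "measure W {2 * a..} = (xmin / (2 * a)) powr (1 + \<epsilon>)"
      using measure_pl_weight_atLeast[of xmin "2 * a" "2 + \<epsilon>"] assms xmin eps by simp
    also have "\<dots> = (xmin / a) powr (1 + \<epsilon>) * (1/2) powr (1 + \<epsilon>)"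
      using a xmin by (subst powr_mult[symmetric]) (auto simp: mult.commute)
    also have "\<dots> \<le> (xmin / a) powr (1 + \<epsilon>) * (1/2) powr 1"
      using eps by (intro mult_left_mono powr_mono') auto
    finally show ?thesis by simp
  qed
  ultimately show ?thesis by simp
qed

text \<open>Formulated through measurable exceptional sets, since the lower bound
  \<open>xmin\<close> on the weights holds only almost everywhere.\<close>

lemma good_weights_whp:
  "\<exists>Z. (\<forall>n. Z n \<in> sets (WW n)) \<and> (\<forall>n. AE p in WW n. p \<notin> Z n \<longrightarrow> good_weights n p) \<and>
     (\<lambda>n. measure (WW n) (Z n)) \<longlonglongrightarrow> 0"
proof -
  define M where "M = (\<integral>t. t powr (1 + \<epsilon> / 2) \<partial>W)"
  \<comment> \<open>On the complement of \<open>Z1\<close> the truncation in \<open>Z2\<close> has no effect.\<close>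
  define Z1 where "Z1 = (\<lambda>n. {p \<in> space (WW n). \<exists>i<n. n / 4 \<le> p i})"
  define Z2 where "Z2 = (\<lambda>n. {p \<in> space (WW n). 2 * mean * n \<le> (\<Sum>i<n. min (p i) (n / 4))})"
  \<comment> \<open>The halves here and in \<open>Z4\<close> are left unsimplified to match
    \<open>m / 2\<close> in \<open>prob_few_weights_in\<close>.\<close>
  define Z3 where "Z3 = (\<lambda>n. {p \<in> space (WW n). real (card (light n p)) < (n / 2) / 2})"
  define Z4 where "Z4 = (\<lambda>n. {p \<in> space (WW n).
      real (card (hubs n p)) < (2 * hub_const * n powr ((1 - \<epsilon>) / 2)) / 2})"
  define Z where "Z = (\<lambda>n. Z1 n \<union> Z2 n \<union> (Z3 n \<union> Z4 n))"
  \<comment> \<open>The four terms are of order n powr (-\<epsilon>), n powr (-\<epsilon>/2), 1/n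
    and n powr (-(1 - \<epsilon>)/2).\<close>
  define r where "r = (\<lambda>n. real n * (xmin / (n / 4)) powr (1 + \<epsilon>)
      + 4 * M / xmin\<^sup>2 * ((n / 4) powr (1 - \<epsilon> / 2) / n)
      + (4 / (n / 2) + 4 / (2 * hub_const * n powr ((1 - \<epsilon>) / 2))))"
  have comp: "(\<lambda>p. p i) \<in> borel_measurable (WW n)" if "i < n" for i n
    using measurable_component_singleton[of i "{..<n}" "\<lambda>_. W"] that by simp
  have ev: "{p \<in> space (WW n). p i \<in> S} \<in> sets (WW n)" if "i < n" "S \<in> sets borel" for i n S
    using measurable_sets[OF comp[OF that(1)] that(2)] by (simp add: vimage_def Int_def conj_commute)
  have card_meas: "{p \<in> space (WW n). real (card {i. i < n \<and> p i \<in> S}) < c} \<in> sets (WW n)"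
    if "S \<in> sets borel" for n S c
  proof -
    have "(\<lambda>p. real (card {i \<in> {..<n}. p \<in> {p \<in> space (WW n). p i \<in> S}})) \<in> borel_measurable (WW n)"
      using ev that by (intro borel_measurable_card_events) auto
    from borel_measurable_less[OF this borel_measurable_const[of c]]
    show ?thesis by (rule back_subst[where P = "\<lambda>X. X \<in> sets (WW n)"]) (auto cong: conj_cong)
  qed
  have light_eq: "light n p = {i. i < n \<and> p i \<in> {..<2 * xmin}}" for n p by (auto simp: light_def)
  have hubs_eq: "hubs n p = {i. i < n \<and> p i \<in> {hub_scale * sqrt n..<2 * (hub_scale * sqrt n)}}" for n p
    by (auto simp: hubs_def)
  have sets: "Z1 n \<in> sets (WW n)" "Z2 n \<in> sets (WW n)" "Z3 n \<in> sets (WW n)" "Z4 n \<in> sets (WW n)" for n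
  proof -
    have "Z1 n = (\<Union>i<n. {p \<in> space (WW n). p i \<in> {n / 4..}})" by (auto simp: Z1_def)
    then show "Z1 n \<in> sets (WW n)" using ev by auto
    have "(\<lambda>p. \<Sum>i<n. min (p i) (n / 4)) \<in> borel_measurable (WW n)"
      using comp by (intro borel_measurable_sum borel_measurable_min) auto
    then show "Z2 n \<in> sets (WW n)"
      unfolding Z2_def by (intro borel_measurable_le borel_measurable_const)
    show "Z3 n \<in> sets (WW n)" "Z4 n \<in> sets (WW n)"
      unfolding Z3_def Z4_def light_eq hubs_eq by (rule card_meas; simp)+
  qed
  have good: "AE p in WW n. p \<notin> Z n \<longrightarrow> good_weights n p" for n
    using AE_weights_ge[of n] AE_space
  proof eventually_elim
    case (elim p)
    show ?case
    proof
      assume p: "p \<notin> Z n"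
      then have le: "p i \<le> n / 4" if "i < n" for i
        using that elim by (auto simp: Z_def Z1_def not_le less_imp_le)
      then have "(\<Sum>i<n. min (p i) (n / 4)) = (\<Sum>i<n. p i)" by (intro sum.cong) auto
      then show "good_weights n p"
        using p elim le by (auto simp: good_weights_def Z_def Z2_def Z3_def Z4_def)
    qed
  qed
  have bound: "\<forall>\<^sub>F n in sequentially. measure (WW n) (Z n) \<le> r n"
  proof -
    have "\<forall>\<^sub>F n in sequentially. xmin \<le> real n / 4" by real_asymp
    moreover have "\<forall>\<^sub>F n in sequentially. xmin \<le> hub_scale * sqrt (real n)"
      using hub_scale_pos by real_asymp
    moreover have "\<forall>\<^sub>F n :: nat in sequentially. 0 < n" by (rule eventually_gt_at_top)
    ultimately show ?thesis
    proof eventually_elim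
      case (elim n)
      interpret WW: prob_space "WW n" by (rule prob_space_WW)
      have "WW.prob (Z1 n) \<le> real n * (xmin / (n / 4)) powr (1 + \<epsilon>)"
        unfolding Z1_def using elim by (intro prob_large_weight)
      moreover have "WW.prob (Z2 n) \<le> 4 * M / xmin\<^sup>2 * ((n / 4) powr (1 - \<epsilon> / 2) / n)"
        unfolding Z2_def M_def using elim by (intro prob_large_volume)
      moreover have "WW.prob (Z3 n) \<le> 4 / (n / 2)"
        unfolding Z3_def light_eq
      proof (rule prob_few_weights_in)
        show "real n / 2 \<le> real n * measure W {..<2 * xmin}"
          using mult_left_mono[OF measure_light_ge, of "real n"] by simp
      qed (use elim in auto)
      moreover have "WW.prob (Z4 n) \<le> 4 / (2 * hub_const * n powr ((1 - \<epsilon>) / 2))"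
        unfolding Z4_def hubs_eq
      proof (rule prob_few_weights_in)
        have n: "0 < real n" using elim by simp
        have "2 * hub_const * n powr ((1 - \<epsilon>) / 2)
            = (xmin / hub_scale) powr (1 + \<epsilon>) / 2 * (real n * n powr (- (1 + \<epsilon>) / 2))"
        proof -
          have e: "1 + - (1 + \<epsilon>) / 2 = (1 - \<epsilon>) / 2" by (simp add: field_simps)
          have "real n * n powr (- (1 + \<epsilon>) / 2) = n powr ((1 - \<epsilon>) / 2)"
            using n unfolding e[symmetric] by (intro powr_mult_base) auto
          then show ?thesis by (simp add: hub_const_def)
        qed
        also have "\<dots> = real n * ((xmin / hub_scale) powr (1 + \<epsilon>) * (1 / sqrt n) powr (1 + \<epsilon>) / 2)"
        proof -
          have "(1 / sqrt n) powr (1 + \<epsilon>) = n powr (- (1 + \<epsilon>) / 2)"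
            using n unfolding minus_divide_left[symmetric] powr_minus_divide
            by (simp add: powr_half_sqrt[symmetric] powr_powr powr_divide)
          then show ?thesis by simp
        qed
        also have "\<dots> = real n * ((xmin / (hub_scale * sqrt n)) powr (1 + \<epsilon>) / 2)"
          using xmin hub_scale_pos n by (subst powr_mult[symmetric]) auto
        also have "\<dots> \<le> real n * measure W {hub_scale * sqrt n..<2 * (hub_scale * sqrt n)}"
          using elim by (intro mult_left_mono measure_hub_ge) auto
        finally show "2 * hub_const * n powr ((1 - \<epsilon>) / 2)
            \<le> real n * measure W {hub_scale * sqrt n..<2 * (hub_scale * sqrt n)}" .
      qed (use elim hub_const_pos in auto)
      moreover have "WW.prob (Z n) \<le> WW.prob (Z1 n) + WW.prob (Z2 n) + (WW.prob (Z3 n) + WW.prob (Z4 n))"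
        unfolding Z_def using sets
        by (intro order_trans[OF measure_Un_le] add_mono measure_Un_le) auto
      ultimately show ?case by (simp add: r_def)
    qed
  qed
  have "r \<longlonglongrightarrow> 0"
  proof -
    have "(\<lambda>n. real n * (xmin / (n / 4)) powr (1 + \<epsilon>)) \<longlonglongrightarrow> 0"
      using xmin eps by real_asymp
    moreover have "(\<lambda>n. (real n / 4) powr (1 - \<epsilon> / 2) / n) \<longlonglongrightarrow> 0"
      using eps by real_asymp
    moreover have "(\<lambda>n. 4 / (real n / 2)) \<longlonglongrightarrow> 0" by real_asymp
    moreover have "(\<lambda>n. 4 / (2 * hub_const * n powr ((1 - \<epsilon>) / 2))) \<longlonglongrightarrow> 0"
      using eps hub_const_pos by real_asymp
    ultimately show ?thesis
      unfolding r_def by (intro tendsto_add_zero tendsto_mult_right_zero)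
  qed
  then have "(\<lambda>n. measure (WW n) (Z n)) \<longlonglongrightarrow> 0"
    using tendsto_sandwich[OF _ bound tendsto_const, of 0] by simp
  moreover have "Z n \<in> sets (WW n)" for n unfolding Z_def using sets by auto
  ultimately show ?thesis using good by blast
qed

end

section \<open>The random power law graph\<close>

text \<open>The value 0 at indices that are not pairs keeps the function within [0,1] everywhere, as
  the lemmas on \<open>edge_pmf\<close> demand.\<close>

definition edge_prob :: "nat \<Rightarrow> (nat \<Rightarrow> real) \<Rightarrow> nat \<times> nat \<Rightarrow> real" where
  "edge_prob n p e =
     (if e \<in> vpairs n then min (p (fst e) * p (snd e) / (\<Sum>z<n. p z)) 1 else 0)"

lemma edge_prob_edge:
  "x < n \<Longrightarrow> y < n \<Longrightarrow> x \<noteq> y \<Longrightarrow> edge_prob n p (edge x y) = min (p x * p y / (\<Sum>z<n. p z)) 1"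
  unfolding edge_prob_def by (simp only: edge_in_vpairs) (simp add: edge_def min_def max_def mult.commute)

lemma plg_adj_eq_graph_adj:
  "plg_adj n (p, u) = graph_adj n (\<lambda>e. e \<in> vpairs n \<and> u e < edge_prob n p e)"
  by (intro ext) (auto simp: plg_adj_def graph_adj_def edge_prob_edge edge_def[symmetric])

context pl_weights begin

abbreviation UU where "UU n \<equiv> PiM (vpairs n) (\<lambda>_. uniform01)"

abbreviation PLG where "PLG n \<equiv> plg_space n xmin (2 + \<epsilon>)"

lemma PLG_eq: "PLG n = WW n \<Otimes>\<^sub>M UU n"
  by (simp add: plg_space_def)

lemma prob_space_UU: "prob_space (UU n)"
  by (intro prob_space_PiM prob_space_uniform01)

lemma prob_space_PLG: "prob_space (PLG n)"
  unfolding PLG_eq by (intro prob_space_pair prob_space_WW prob_space_UU)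

text \<open>The graph takes only finitely many values and each is attained on a measurable set.
  Hence any property \<open>Q\<close> defines an event, even one that quantifies over all
  labelings.\<close>

lemma sets_plg_event: "{\<omega> \<in> space (PLG n). Q (plg_adj n \<omega>)} \<in> sets (PLG n)"
proof -
  define T where "T = (\<lambda>\<omega>. {e \<in> vpairs n. snd \<omega> e < edge_prob n (fst \<omega>) e})"
  have w: "(\<lambda>\<omega>. fst \<omega> x) \<in> borel_measurable (PLG n)" if "x < n" for x
    unfolding PLG_eq
    using measurable_compose[OF measurable_fst measurable_component_singleton[of x "{..<n}" "\<lambda>_. W"]] that
    by simp
  have u: "(\<lambda>\<omega>. snd \<omega> e) \<in> borel_measurable (PLG n)" if "e \<in> vpairs n" for e
    unfolding PLG_eq
    using measurable_compose[OF measurable_snd measurable_component_singleton[of e "vpairs n" "\<lambda>_. uniform01"]] that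
    by simp
  have e_sets: "{\<omega> \<in> space (PLG n). snd \<omega> e < edge_prob n (fst \<omega>) e} \<in> sets (PLG n)"
    if e: "e \<in> vpairs n" for e
  proof -
    have "fst e < n" "snd e < n" using e by (auto simp: vpairs_def)
    then have "(\<lambda>\<omega>. edge_prob n (fst \<omega>) e) \<in> borel_measurable (PLG n)"
      unfolding edge_prob_def if_P[OF e] using w
      by (intro borel_measurable_min borel_measurable_divide borel_measurable_times
          borel_measurable_sum borel_measurable_const) auto
    with u[OF e] show ?thesis by (rule borel_measurable_less)
  qed
  have T_sets: "{\<omega> \<in> space (PLG n). T \<omega> = S} \<in> sets (PLG n)" if "S \<subseteq> vpairs n" for S
  proof -
    have "{\<omega> \<in> space (PLG n). T \<omega> = S}
        = {\<omega> \<in> space (PLG n). \<forall>e\<in>vpairs n. snd \<omega> e < edge_prob n (fst \<omega>) e \<longleftrightarrow> e \<in> S}"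
      using that by (auto simp: T_def)
    also have "\<dots> \<in> sets (PLG n)"
    proof (rule sets.sets_Collect_finite_All)
      fix e assume e: "e \<in> vpairs n"
      show "{\<omega> \<in> space (PLG n). snd \<omega> e < edge_prob n (fst \<omega>) e \<longleftrightarrow> e \<in> S} \<in> sets (PLG n)"
        using e_sets[OF e] sets.sets_Collect_neg[OF e_sets[OF e]] by (cases "e \<in> S") auto
    qed simp
    finally show ?thesis .
  qed
  have "{\<omega> \<in> space (PLG n). Q (plg_adj n \<omega>)}
      = (\<Union>S\<in>{S \<in> Pow (vpairs n). Q (graph_adj n (\<lambda>e. e \<in> S))}. {\<omega> \<in> space (PLG n). T \<omega> = S})"
  proof -
    have "plg_adj n \<omega> = graph_adj n (\<lambda>e. e \<in> T \<omega>)" for \<omega>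
      using plg_adj_eq_graph_adj[of n "fst \<omega>" "snd \<omega>"] by (simp add: T_def)
    moreover have "T \<omega> \<subseteq> vpairs n" for \<omega> by (auto simp: T_def)
    ultimately show ?thesis by auto
  qed
  also have "\<dots> \<in> sets (PLG n)"
    using T_sets by (intro sets.finite_UN) (auto intro: finite_subset[of _ "Pow (vpairs n)"])
  finally show ?thesis .
qed

lemma good_weights_edge_prob:
  assumes "good_weights n p"
  shows "0 \<le> edge_prob n p e \<and> edge_prob n p e \<le> 1"
proof -
  have p: "0 \<le> p i" if "i < n" for i using assms that xmin by (force simp: good_weights_def)
  then have "0 \<le> p (fst e) * p (snd e) / (\<Sum>z<n. p z)" if "e \<in> vpairs n"
    using that by (intro divide_nonneg_nonneg mult_nonneg_nonneg sum_nonneg) (auto simp: vpairs_def)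
  then show ?thesis by (auto simp: edge_prob_def)
qed

text \<open>Fubini: fix the weights and integrate the conditional failure probability, which is at
  most 1 on \<open>Z\<close> and at most \<delta> almost everywhere else.\<close>

lemma prob_PLG_ge:
  assumes Z: "Z \<in> sets (WW n)" "AE p in WW n. p \<notin> Z \<longrightarrow> good_weights n p"
    and "0 \<le> \<delta>"
    and cond: "\<And>p. good_weights n p \<Longrightarrow>
      measure_pmf.prob (edge_pmf n (edge_prob n p)) {F. \<not> Q (graph_adj n F)} \<le> \<delta>"
  shows "1 - (measure (WW n) Z + \<delta>) \<le> measure (PLG n) {\<omega> \<in> space (PLG n). Q (plg_adj n \<omega>)}"
proof -
  interpret WW: prob_space "WW n" by (rule prob_space_WW)
  interpret UU: prob_space "UU n" by (rule prob_space_UU)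
  interpret PLG: prob_space "PLG n" by (rule prob_space_PLG)
  define X where "X = {\<omega> \<in> space (PLG n). \<not> Q (plg_adj n \<omega>)}"
  have X: "X \<in> sets (WW n \<Otimes>\<^sub>M UU n)"
    using sets_plg_event[of n "\<lambda>E. \<not> Q E"] by (simp add: X_def PLG_eq)
  have "emeasure (WW n \<Otimes>\<^sub>M UU n) X = (\<integral>\<^sup>+p. emeasure (UU n) (Pair p -` X) \<partial>WW n)"
    by (rule UU.emeasure_pair_measure_alt[OF X])
  also have "\<dots> \<le> (\<integral>\<^sup>+p. indicator Z p + ennreal \<delta> \<partial>WW n)"
  proof (rule nn_integral_mono_AE)
    show "AE p in WW n. emeasure (UU n) (Pair p -` X) \<le> indicator Z p + ennreal \<delta>"
      using Z(2) AE_space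
    proof eventually_elim
      case (elim p)
      show ?case
      proof (cases "p \<in> Z")
        case True
        have "emeasure (UU n) (Pair p -` X) \<le> 1" by (rule UU.emeasure_le_1)
        also have "\<dots> \<le> indicator Z p + ennreal \<delta>" using True by simp
        finally show ?thesis .
      next
        case False
        then have good: "good_weights n p" using elim by simp
        have "Pair p -` X = {u \<in> space (UU n).
            \<not> Q (graph_adj n (\<lambda>e. e \<in> vpairs n \<and> u e < edge_prob n p e))}"
          using elim by (auto simp: X_def PLG_eq space_pair_measure plg_adj_eq_graph_adj)
        then have "measure (UU n) (Pair p -` X)
            = measure_pmf.prob (edge_pmf n (edge_prob n p)) {F. \<not> Q (graph_adj n F)}"
          using uniform01_threshold_eq_edge_pmf[where q = "edge_prob n p" and n = n
              and Q = "\<lambda>F. \<not> Q (graph_adj n F)", OF good_weights_edge_prob[OF good]] by simp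
        then show ?thesis
          using cond[OF good] False by (simp add: UU.emeasure_eq_measure ennreal_leI)
      qed
    qed
  qed
  also have "\<dots> = emeasure (WW n) Z + ennreal \<delta>"
    using Z(1) by (subst nn_integral_add) (auto simp: WW.emeasure_space_1)
  finally have "ennreal (PLG.prob X) \<le> ennreal (WW.prob Z + \<delta>)"
    using \<open>0 \<le> \<delta>\<close> by (simp add: PLG_eq[symmetric] PLG.emeasure_eq_measure WW.emeasure_eq_measure)
  then have "PLG.prob X \<le> WW.prob Z + \<delta>"
    using \<open>0 \<le> \<delta>\<close> ennreal_le_iff[of "WW.prob Z + \<delta>"] by (simp del: ennreal_plus)
  moreover have "PLG.prob {\<omega> \<in> space (PLG n). Q (plg_adj n \<omega>)} = 1 - PLG.prob X"
    using PLG.prob_neg[OF sets_plg_event[of n Q]] by (simp add: X_def)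
  ultimately show ?thesis by simp
qed

section \<open>Constants, and the hub graph for good weights\<close>

text \<open>Two weights of at least \<open>hub_scale\<close> * \<surd>n, divided by a volume of at
  most 2 * \<open>mean\<close> * n.\<close>

definition edge_const :: real where "edge_const = hub_scale\<^sup>2 / (2 * mean)"

text \<open>Times \<surd>n, this is the product of n/4 light vertices, the least edge probability
  \<open>hub_scale * xmin / (2 * mean * sqrt n)\<close> to a hub, and the factor exp (-2D) with D =
  2 * \<open>xmin\<close>.\<close>

definition leaf_const :: real where
  "leaf_const = hub_scale * xmin * exp (- 4 * xmin) / (8 * mean)"

text \<open>A deterministic number, to which the set of hubs is cut down, so that the bounds are
  uniform over all good weights.\<close>

definition num_hubs :: "nat \<Rightarrow> nat" where
  "num_hubs n = nat \<lceil>hub_const * n powr ((1 - \<epsilon>) / 2)\<rceil>"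

text \<open>The expected degree of a light vertex is at most its weight, hence D = 2 *
  \<open>xmin\<close>. Two light vertices are joined with probability at most (2 *
  \<open>xmin\<close>)^2 / (\<open>xmin\<close> * n), hence \<tau> = 8 * \<open>xmin\<close> /
  n.\<close>

lemma good_weights_hub_graph:
  assumes good: "good_weights n p"
    and n: "0 < n" "2 * xmin \<le> hub_scale * sqrt n"
    and k: "2 \<le> hub_const * n powr ((1 - \<epsilon>) / 2)"
      "16 \<le> edge_const * (hub_const * n powr ((1 - \<epsilon>) / 2))"
    and mean: "0 < mean"
  shows "\<exists>H. hub_graph n (edge_prob n p) H (light n p) (num_hubs n)
      (hub_scale * xmin / (2 * mean * sqrt n)) (2 * xmin) (8 * xmin / n) edge_const (leaf_const * sqrt n)"
proof -
  define vol where "vol = (\<Sum>z<n. p z)"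
  have p: "xmin \<le> p i" "p i \<le> n / 4" if "i < n" for i using good that by (auto simp: good_weights_def)
  have "real n * xmin \<le> vol" using p sum_bounded_below[of "{..<n}" xmin p] by (simp add: vol_def)
  moreover have vol_le: "vol \<le> 2 * mean * n" using good by (simp add: good_weights_def vol_def)
  moreover have "0 < real n * xmin" using xmin n by simp
  ultimately have vol: "0 < vol" "xmin * n \<le> vol" by (auto simp: mult.commute)
  have num: "hub_const * n powr ((1 - \<epsilon>) / 2) \<le> num_hubs n"
    unfolding num_hubs_def by linarith
  have "num_hubs n \<le> card (hubs n p)"
    using good by (simp add: good_weights_def num_hubs_def nat_le_iff ceiling_le_iff)
  then obtain H where H: "H \<subseteq> hubs n p" "card H = num_hubs n" by (rule obtain_subset_with_card_n) auto
  have Hp: "i < n" "hub_scale * sqrt n \<le> p i" "p i \<le> 2 * (hub_scale * sqrt n)" if "i \<in> H" for i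
    using H(1) that by (auto simp: hubs_def)
  have light: "x < n" "xmin \<le> p x" "p x \<le> 2 * xmin" if "x \<in> light n p" for x
    using that p by (auto simp: light_def)
  have q: "0 \<le> edge_prob n p e \<and> edge_prob n p e \<le> 1" for e
    by (rule good_weights_edge_prob[OF good])
  have q_le: "edge_prob n p (edge x y) \<le> c / d"
    if "x < n" "y < n" "x \<noteq> y" "p x * p y \<le> c" "0 < d" "d \<le> vol" for x y c d
  proof -
    have "0 \<le> p x * p y" using p xmin that by (intro mult_nonneg_nonneg) force+
    then have "p x * p y / vol \<le> c / d" using that by (intro frac_le) auto
    then show ?thesis using edge_prob_edge[of x n y p] that by (simp add: vol_def)
  qed
  \<comment> \<open>The hypothesis that the probability is at most 1/2 ensures that the truncation
    at 1 is inactive.\<close>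
  have q_ge: "c / (2 * mean * n) \<le> edge_prob n p (edge x y)"
    if "x < n" "y < n" "x \<noteq> y" "0 \<le> c" "c \<le> p x * p y" "edge_prob n p (edge x y) \<le> 1/2" for x y c
  proof -
    have "c / (2 * mean * n) \<le> p x * p y / vol" using that vol vol_le by (intro frac_le) auto
    then show ?thesis using edge_prob_edge[of x n y p] that by (simp add: vol_def)
  qed
  have half: "edge_prob n p (edge x y) \<le> 1/2" if "x \<in> light n p" "y < n" "y \<noteq> x" for x y
  proof -
    have "p x * p y \<le> (2 * xmin) * (n / 4)" using light[OF that(1)] p[OF that(2)] xmin by (intro mult_mono) auto
    then have "edge_prob n p (edge x y) \<le> (2 * xmin) * (n / 4) / (xmin * n)"
      using that light xmin n vol by (intro q_le) auto
    then show ?thesis using xmin n by simp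
  qed
  have scale2: "hub_scale\<^sup>2 = xmin / 8" using xmin by (simp add: hub_scale_def)
  have sqrt2: "(hub_scale * sqrt n) * (hub_scale * sqrt n) = hub_scale\<^sup>2 * n"
    by (simp add: power2_eq_square)
  have hub_le: "edge_prob n p (edge x y) \<le> 1/2" if "x \<in> H" "y \<in> H" "x \<noteq> y" for x y
  proof -
    have "p x * p y \<le> (2 * (hub_scale * sqrt n)) * (2 * (hub_scale * sqrt n))"
      using Hp[OF that(1)] Hp[OF that(2)] hub_scale_pos p[of y] xmin by (intro mult_mono) auto
    also have "\<dots> = xmin * n / 2" using sqrt2 scale2 by simp
    finally have "edge_prob n p (edge x y) \<le> (xmin * n / 2) / (xmin * n)"
      using that Hp xmin n vol by (intro q_le) auto
    then show ?thesis using xmin n by simp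
  qed
  have hub_ge: "edge_const \<le> edge_prob n p (edge x y)" if "x \<in> H" "y \<in> H" "x \<noteq> y" for x y
  proof -
    have "hub_scale\<^sup>2 * n \<le> p x * p y"
      unfolding sqrt2[symmetric]
      using Hp[OF that(1)] Hp[OF that(2)] hub_scale_pos p[of x] xmin by (intro mult_mono) auto
    then have "hub_scale\<^sup>2 * n / (2 * mean * n) \<le> edge_prob n p (edge x y)"
      using that Hp hub_le by (intro q_ge) auto
    then show ?thesis using n by (simp add: edge_const_def)
  qed
  have disj: "light n p \<inter> H = {}"
    using Hp(2) n(2) by (force simp: light_def)
  have "hub_graph n (edge_prob n p) H (light n p) (num_hubs n)
      (hub_scale * xmin / (2 * mean * sqrt n)) (2 * xmin) (8 * xmin / n) edge_const (leaf_const * sqrt n)"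
  \<comment> \<open>The cases follow the assumptions of \<open>hub_graph\<close>: 1 is
    \<open>q\<close>, 2-3 \<open>H\<close>, 4-6 \<open>B\<close>, 7 \<open>half\<close>, 8
    \<open>deg\<close>, 9-10 \<open>s\<close>, 11-12 \<open>\<tau>\<close>, 13-14
    \<open>\<mu>\<close>, 15-16 \<open>\<eta>\<close>, 17-18 \<open>k\<close>.\<close>
  proof (unfold_locales, goal_cases)
    case (1 e)
    then show ?case using q by simp
  next
    case 2
    then show ?case using Hp by auto
  next
    case 3
    then show ?case by (rule H(2))
  next
    case 4
    then show ?case by (auto simp: light_def)
  next
    case 5
    then show ?case by (rule disj)
  next
    case 6
    have "0 < real (card (light n p))" using good n(1) by (simp add: good_weights_def)
    then show ?case by auto
  next
    case (7 x y)
    then show ?case by (rule half)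
  next
    case (8 x)
    \<comment> \<open>Dropping the truncation and restoring the term y = x lets the volume cancel,
      which leaves the weight of \<open>x\<close>.\<close>
    have "(\<Sum>y\<in>{..<n} - {x}. edge_prob n p (edge x y)) \<le> (\<Sum>y\<in>{..<n} - {x}. p x * p y / vol)"
      using light[OF 8] edge_prob_edge[of x n _ p] by (intro sum_mono) (auto simp: vol_def)
    also have "\<dots> \<le> (\<Sum>y<n. p x * p y / vol)"
      using light[OF 8] p xmin vol by (intro sum_mono2 divide_nonneg_nonneg mult_nonneg_nonneg) force+
    also have "\<dots> = p x" using vol by (simp add: vol_def flip: sum_divide_distrib sum_distrib_left)
    finally show ?case using light(3)[OF 8] by simp
  next
    case 9
    then show ?case using hub_scale_pos xmin mean n by simp
  next
    case (10 x h)
    have x: "x < n" "h < n" "x \<noteq> h" using 10 light Hp disj by auto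
    have "xmin * (hub_scale * sqrt n) \<le> p x * p h"
      using light[OF 10(1)] Hp[OF 10(2)] hub_scale_pos xmin by (intro mult_mono) auto
    then have "xmin * (hub_scale * sqrt n) / (2 * mean * n) \<le> edge_prob n p (edge x h)"
      using x half[OF 10(1), of h] hub_scale_pos xmin by (intro q_ge) auto
    moreover have "real n = sqrt n * sqrt n" by simp
    then have "xmin * (hub_scale * sqrt n) / (2 * mean * n) = hub_scale * xmin / (2 * mean * sqrt n)"
      using n mean by (simp add: field_simps)
    ultimately show ?case by simp
  next
    case 11
    then show ?case using xmin by simp
  next
    case (12 x x')
    have "p x * p x' \<le> (2 * xmin) * (2 * xmin)"
      using light[OF 12(1)] light[OF 12(2)] xmin by (intro mult_mono) auto
    then have "edge_prob n p (edge x x') \<le> (2 * xmin) * (2 * xmin) / (xmin * n)"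
      using 12 light xmin n vol by (intro q_le) auto
    then show ?case using xmin n by (simp add: field_simps)
  next
    case 13
    then show ?case using hub_scale_pos xmin mean n by (simp add: leaf_const_def)
  next
    case 14
    have "leaf_const * sqrt n = n / 4 * (hub_scale * xmin / (2 * mean * sqrt n) * exp (- 2 * (2 * xmin)))"
    proof -
      have "real n = sqrt n * sqrt n" by simp
      then show ?thesis using n mean by (simp add: leaf_const_def field_simps)
    qed
    also have "\<dots> \<le> card (light n p) * (hub_scale * xmin / (2 * mean * sqrt n) * exp (- 2 * (2 * xmin)))"
      using good hub_scale_pos xmin mean by (intro mult_right_mono) (auto simp: good_weights_def)
    finally show ?case .
  next
    case 15
    then show ?case using hub_scale_pos mean by (simp add: edge_const_def)
  next
    case (16 e)
    then show ?case
      using hub_ge[of "fst e" "snd e"] hub_le[of "fst e" "snd e"] edge_fst_snd[of e]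
      by (simp add: pairs_in_def)
  next
    case 17
    have "2 \<le> real (num_hubs n)" using num k(1) by linarith
    then show ?case by simp
  next
    case 18
    have "edge_const * (hub_const * n powr ((1 - \<epsilon>) / 2)) \<le> edge_const * num_hubs n"
      using num hub_scale_pos mean by (intro mult_left_mono) (auto simp: edge_const_def)
    then show ?case using k(2) by simp
  qed
  then show ?thesis by blast
qed

section \<open>Error terms and the passage to the limit\<close>

definition label_const :: real where
  "label_const = leaf_const * edge_const * hub_const\<^sup>2 / 16"

text \<open>The number of hubs is replaced by its upper bound in the first summand and its lower
  bound in the second. The orders are n powr (-\<epsilon>/2) and n powr (-(1 - \<epsilon>)).\<close>

definition error_bound :: "nat \<Rightarrow> real" where
  "error_bound n = (hub_const * n powr ((1 - \<epsilon>) / 2) + 1) * (4 * (1 / (leaf_const * sqrt n) + 8 * xmin / n))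
      + 16 / (edge_const * (hub_const * n powr ((1 - \<epsilon>) / 2))\<^sup>2)"

lemma
  assumes "0 < mean"
  shows leaf_const_pos: "0 < leaf_const" and edge_const_pos: "0 < edge_const"
    and label_const_pos: "0 < label_const"
  using assms hub_scale_pos hub_const_pos xmin
  by (simp_all add: label_const_def leaf_const_def edge_const_def)

lemma error_bound_tendsto_0:
  assumes "0 < mean"
  shows "error_bound \<longlonglongrightarrow> 0"
proof -
  note pos = leaf_const_pos[OF assms] edge_const_pos[OF assms] hub_const_pos xmin eps
  have "(\<lambda>n. (hub_const * real n powr ((1 - \<epsilon>) / 2) + 1) * (4 * (1 / (leaf_const * sqrt n) + 8 * xmin / n))) \<longlonglongrightarrow> 0"
    using pos by real_asymp
  moreover have "(\<lambda>n. 16 / (edge_const * (hub_const * real n powr ((1 - \<epsilon>) / 2))\<^sup>2)) \<longlonglongrightarrow> 0"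
    using pos by real_asymp
  ultimately show ?thesis
    unfolding error_bound_def by (intro tendsto_add_zero)
qed

lemma eventually_hub_graph:
  assumes mean: "0 < mean"
  shows "\<forall>\<^sub>F n in sequentially. \<forall>p. good_weights n p \<longrightarrow>
     (\<exists>H. hub_graph n (edge_prob n p) H (light n p) (num_hubs n)
      (hub_scale * xmin / (2 * mean * sqrt n)) (2 * xmin) (8 * xmin / n) edge_const (leaf_const * sqrt n))"
proof -
  note pos = leaf_const_pos[OF assms] edge_const_pos[OF assms] hub_const_pos hub_scale_pos xmin eps
  have "\<forall>\<^sub>F n :: nat in sequentially. 0 < n" by (rule eventually_gt_at_top)
  moreover have "\<forall>\<^sub>F n in sequentially. 2 * xmin \<le> hub_scale * sqrt (real n)"
    using pos by real_asymp
  moreover have "\<forall>\<^sub>F n in sequentially. 2 \<le> hub_const * real n powr ((1 - \<epsilon>) / 2)"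
    using pos by real_asymp
  moreover have "\<forall>\<^sub>F n in sequentially. 16 \<le> edge_const * (hub_const * real n powr ((1 - \<epsilon>) / 2))"
    using pos by real_asymp
  ultimately show ?thesis
    by eventually_elim (use good_weights_hub_graph mean in blast)
qed

lemma num_hubs_bounds:
  "hub_const * n powr ((1 - \<epsilon>) / 2) \<le> num_hubs n"
  "num_hubs n \<le> hub_const * n powr ((1 - \<epsilon>) / 2) + 1"
proof -
  have "0 \<le> hub_const * n powr ((1 - \<epsilon>) / 2)" using hub_const_pos by simp
  then show "hub_const * n powr ((1 - \<epsilon>) / 2) \<le> num_hubs n"
    "num_hubs n \<le> hub_const * n powr ((1 - \<epsilon>) / 2) + 1"
    unfolding num_hubs_def by linarith+
qed

lemma label_const_le:
  assumes "0 < mean" "0 < n"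
  shows "label_const * n powr (3/2 - \<epsilon>) \<le> leaf_const * sqrt n * edge_const * (num_hubs n)\<^sup>2 / 16"
proof -
  note pos = leaf_const_pos[OF assms(1)] edge_const_pos[OF assms(1)] hub_const_pos
  have "n powr (3/2 - \<epsilon>) = n powr (1/2) * (n powr ((1 - \<epsilon>) / 2) * n powr ((1 - \<epsilon>) / 2))"
  proof -
    have "3/2 - \<epsilon> = 1/2 + ((1 - \<epsilon>) / 2 + (1 - \<epsilon>) / 2)" by (simp add: field_simps)
    then show ?thesis by (simp only: powr_add)
  qed
  then have "label_const * n powr (3/2 - \<epsilon>)
      = leaf_const * sqrt n * edge_const * (hub_const * n powr ((1 - \<epsilon>) / 2))\<^sup>2 / 16"
    by (simp add: label_const_def powr_half_sqrt power2_eq_square)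
  also have "\<dots> \<le> leaf_const * sqrt n * edge_const * (num_hubs n)\<^sup>2 / 16"
    using num_hubs_bounds(1)[of n] pos
    by (intro divide_right_mono mult_left_mono) (auto intro!: power_mono)
  finally show ?thesis .
qed

lemma error_bound_ge:
  assumes "0 < mean" "0 < n"
  shows "num_hubs n * (4 * (1 / (leaf_const * sqrt n) + 8 * xmin / n))
      + 16 / (edge_const * (num_hubs n)\<^sup>2) \<le> error_bound n"
proof -
  note pos = leaf_const_pos[OF assms(1)] edge_const_pos[OF assms(1)] hub_const_pos xmin
  have h: "0 < hub_const * n powr ((1 - \<epsilon>) / 2)" using pos assms by simp
  have "edge_const * (hub_const * n powr ((1 - \<epsilon>) / 2))\<^sup>2 \<le> edge_const * (real (num_hubs n))\<^sup>2"
    using num_hubs_bounds(1)[of n] pos h by (intro mult_left_mono power_mono) auto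
  moreover have "0 < edge_const * (hub_const * n powr ((1 - \<epsilon>) / 2))\<^sup>2"
    using pos(2,3) assms(2) by simp
  ultimately have "16 / (edge_const * (real (num_hubs n))\<^sup>2)
      \<le> 16 / (edge_const * (hub_const * n powr ((1 - \<epsilon>) / 2))\<^sup>2)"
    by (intro frac_le) auto
  then show ?thesis
    unfolding error_bound_def using num_hubs_bounds(2)[of n] pos
    by (intro add_mono mult_right_mono) auto
qed

text \<open>Reduces a high-probability statement to one about fixed good weights with a uniform
  error. \<open>Q\<close> may vary with n, as decoder and threshold do.\<close>

lemma whp_if_good_weights:
  assumes ev: "\<forall>\<^sub>F n in sequentially. \<forall>p. good_weights n p \<longrightarrow>
      measure_pmf.prob (edge_pmf n (edge_prob n p)) {F. \<not> Q n (graph_adj n F)} \<le> \<delta> n"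
    and \<delta>: "\<delta> \<longlonglongrightarrow> 0" "\<And>n. 0 \<le> \<delta> n"
  shows "(\<lambda>n. measure (PLG n) {\<omega> \<in> space (PLG n). Q n (plg_adj n \<omega>)}) \<longlonglongrightarrow> 1"
proof -
  obtain Z where Z: "\<And>n. Z n \<in> sets (WW n)" "\<And>n. AE p in WW n. p \<notin> Z n \<longrightarrow> good_weights n p"
    "(\<lambda>n. measure (WW n) (Z n)) \<longlonglongrightarrow> 0"
    using good_weights_whp by blast
  have lower: "\<forall>\<^sub>F n in sequentially. 1 - (measure (WW n) (Z n) + \<delta> n)
      \<le> measure (PLG n) {\<omega> \<in> space (PLG n). Q n (plg_adj n \<omega>)}"
    using ev by eventually_elim (use Z \<delta>(2) in \<open>intro prob_PLG_ge, auto\<close>)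
  have upper: "\<forall>\<^sub>F n in sequentially. measure (PLG n) {\<omega> \<in> space (PLG n). Q n (plg_adj n \<omega>)} \<le> 1"
    using prob_space.prob_le_1[OF prob_space_PLG] by simp
  have "(\<lambda>n. 1 - (measure (WW n) (Z n) + \<delta> n)) \<longlonglongrightarrow> 1 - (0 + 0)"
    by (intro tendsto_intros Z(3) \<delta>(1))
  then show ?thesis using tendsto_sandwich[OF lower upper _ tendsto_const] by simp
qed

lemma error_bound_nonneg: "0 < mean \<Longrightarrow> 0 \<le> error_bound n"
  using leaf_const_pos edge_const_pos hub_const_pos xmin by (simp add: error_bound_def)

lemma distance_labeling_whp:
  fixes Dec :: "nat \<Rightarrow> bool list \<Rightarrow> bool list \<Rightarrow> enat"
  assumes mean: "0 < mean"
  shows "(\<lambda>n. measure (PLG n) {\<omega> \<in> space (PLG n).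
      \<forall>Lab. is_distance_labeling n (plg_adj n \<omega>) (Dec n) Lab \<longrightarrow>
        label_const * n powr (3/2 - \<epsilon>) \<le> labeling_length n Lab}) \<longlonglongrightarrow> 1"
proof (rule whp_if_good_weights[OF _ error_bound_tendsto_0[OF mean] error_bound_nonneg[OF mean]])
  show "\<forall>\<^sub>F n in sequentially. \<forall>p. good_weights n p \<longrightarrow>
      measure_pmf.prob (edge_pmf n (edge_prob n p))
        {F. \<not> (\<forall>Lab. is_distance_labeling n (graph_adj n F) (Dec n) Lab \<longrightarrow>
           label_const * n powr (3/2 - \<epsilon>) \<le> labeling_length n Lab)} \<le> error_bound n"
    using eventually_hub_graph[OF mean] eventually_gt_at_top[of 0]
  proof eventually_elim
    case (elim n)
    show ?case
    proof (intro allI impI)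
      fix p assume "good_weights n p"
      then obtain H where "hub_graph n (edge_prob n p) H (light n p) (num_hubs n)
        (hub_scale * xmin / (2 * mean * sqrt n)) (2 * xmin) (8 * xmin / n) edge_const (leaf_const * sqrt n)"
        using elim by blast
      \<comment> \<open>The bad event for \<open>label_const\<close> is contained in the one bounded
        here, since \<open>label_const_le\<close> shows that its threshold is lower.\<close>
      note bound = hub_graph.prob_short_labeling[OF this, of "Dec n"]
      show "measure_pmf.prob (edge_pmf n (edge_prob n p))
        {F. \<not> (\<forall>Lab. is_distance_labeling n (graph_adj n F) (Dec n) Lab \<longrightarrow>
           label_const * n powr (3/2 - \<epsilon>) \<le> labeling_length n Lab)} \<le> error_bound n"
        using label_const_le[OF mean elim(2)]
        by (intro order_trans[OF measure_pmf.finite_measure_mono order_trans[OF bound error_bound_ge[OF mean elim(2)]]])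
          (auto intro: order_trans)
    qed
  qed
qed

lemma two_hop_cover_whp:
  assumes mean: "0 < mean"
  shows "(\<lambda>n. measure (PLG n) {\<omega> \<in> space (PLG n).
      \<forall>L. is_2hop_cover n (plg_adj n \<omega>) L \<longrightarrow>
        label_const * n powr (3/2 - \<epsilon>) \<le> num_landmarks n L}) \<longlonglongrightarrow> 1"
proof (rule whp_if_good_weights[OF _ error_bound_tendsto_0[OF mean] error_bound_nonneg[OF mean]])
  show "\<forall>\<^sub>F n in sequentially. \<forall>p. good_weights n p \<longrightarrow>
      measure_pmf.prob (edge_pmf n (edge_prob n p))
        {F. \<not> (\<forall>L. is_2hop_cover n (graph_adj n F) L \<longrightarrow>
           label_const * n powr (3/2 - \<epsilon>) \<le> num_landmarks n L)} \<le> error_bound n"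
    using eventually_hub_graph[OF mean] eventually_gt_at_top[of 0]
  proof eventually_elim
    case (elim n)
    show ?case
    proof (intro allI impI)
      fix p assume "good_weights n p"
      then obtain H where "hub_graph n (edge_prob n p) H (light n p) (num_hubs n)
        (hub_scale * xmin / (2 * mean * sqrt n)) (2 * xmin) (8 * xmin / n) edge_const (leaf_const * sqrt n)"
        using elim by blast
      note bound = hub_graph.prob_small_2hop_cover[OF this]
      show "measure_pmf.prob (edge_pmf n (edge_prob n p))
        {F. \<not> (\<forall>L. is_2hop_cover n (graph_adj n F) L \<longrightarrow>
           label_const * n powr (3/2 - \<epsilon>) \<le> num_landmarks n L)} \<le> error_bound n"
        using label_const_le[OF mean elim(2)]
        by (intro order_trans[OF measure_pmf.finite_measure_mono order_trans[OF bound error_bound_ge[OF mean elim(2)]]])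
          (auto intro: order_trans)
    qed
  qed
qed

end

theorem theorem6p4:
  fixes xmin \<epsilon> \<beta> \<nu> :: real
  assumes "xmin > 0"
    and "0 < \<epsilon>" and "\<epsilon> < 1/2"
    and "\<beta> = 2 + \<epsilon>"
    and "\<nu> = pl_mean xmin \<beta>" and "\<nu> > 1"
  shows "\<exists>c>0.
     (\<forall>Dec :: nat \<Rightarrow> bool list \<Rightarrow> bool list \<Rightarrow> enat.
        (\<lambda>n. measure (plg_space n xmin \<beta>)
           {\<omega> \<in> space (plg_space n xmin \<beta>).
              \<forall>Lab. is_distance_labeling n (plg_adj n \<omega>) (Dec n) Lab \<longrightarrow>
                 real (labeling_length n Lab) \<ge> c * real n powr (3/2 - \<epsilon>)})
        \<longlonglongrightarrow> 1)
   \<and> (\<lambda>n. measure (plg_space n xmin \<beta>)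
           {\<omega> \<in> space (plg_space n xmin \<beta>).
              \<forall>L. is_2hop_cover n (plg_adj n \<omega>) L \<longrightarrow>
                 real (num_landmarks n L) \<ge> c * real n powr (3/2 - \<epsilon>)})
        \<longlonglongrightarrow> 1"
proof -
  interpret pl_weights xmin \<epsilon> using assms by unfold_locales auto
  have mean: "0 < mean" using assms by (simp add: pl_mean_def)
  \<comment> \<open>The constant is \<open>label_const\<close> for both parts; it depends on
    \<open>xmin\<close> and \<epsilon> only, so it can be chosen before the decoders.\<close>
  show ?thesis
    using label_const_pos[OF mean] distance_labeling_whp[OF mean] two_hop_cover_whp[OF mean]
    unfolding assms(4) by blast
qed

end
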